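(* Let $|\psi\rangle_{AB}\in\mathcal{H}_A\otimes\mathcal{H}_B$ be a unit vector with Schmidt decomposition $|\psi\rangle_{AB}=\sum_{i}\sqrt{p_i}\,|a_i\rangle_A\otimes|b_i\rangle_B$, with $p_1\ge p_2\ge\dots\ge p_{d_{\min}}\ge 0$, where $d_{\min}=\min\{d_A,d_B\}$, and write $\psi_{AB}=|\psi\rangle\langle\psi|_{AB}$. Then: (i) if $d_{\min}=d_A=d_B$, then $\mathrm{CDP}_A(\psi_{AB})=\mathrm{CDP}_B(\psi_{AB})=p_{d_{\min}}$; (ii) if $d_{\min}=d_A<d_B$, then $\mathrm{CDP}_A(\psi_{AB})=p_{d_{\min}}$ and $\mathrm{CDP}_B(\psi_{AB})=0$.
   Context: All Hilbert spaces are finite dimensional; $d_X=\dim\mathcal{H}_X$. $\{|a_i\rangle\}$ and $\{|b_i\rangle\}$ are orthonormal families, $\sum_i p_i=1$, and Schmidt coefficients beyond the Schmidt rank are taken to be $0$ (so $p_{d_{\min}}$ may vanish). A quantum channel is a completely positive trace-preserving linear map $\mathcal{L}(\mathcal{H}_X)\to\mathcal{L}(\mathcal{H}_Y)$. Let $D(\rho,\sigma)=\frac12\|\rho-\sigma\|_1$ be the trace distance. For channels $\Lambda_0,\Lambda_1$ with the same input system $S$ and the same output system, the diamond distance is $D_\diamond(\Lambda_0,\Lambda_1)=\max_{\rho}D\big((\Lambda_0\otimes\mathrm{id}_{S'})[\rho],(\Lambda_1\otimes\mathrm{id}_{S'})[\rho]\big)$, the maximum being over all density operators $\rho$ on $\mathcal{H}_S\otimes\mathcal{H}_{S'}$,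 with $S'$ a copy of $S$. For a density operator $\rho_{AB}$ on $\mathcal{H}_A\otimes\mathcal{H}_B$, the channel discrimination power on $A$ is $$\mathrm{CDP}_A(\rho_{AB})=\inf_{\Lambda_0\neq\Lambda_1}\frac{D\big((\Lambda_0\otimes\mathrm{id}_B)[\rho_{AB}],(\Lambda_1\otimes\mathrm{id}_B)[\rho_{AB}]\big)}{D_\diamond(\Lambda_0,\Lambda_1)},$$ the infimum being over all pairs of distinct channels with input $\mathcal{L}(\mathcal{H}_A)$ and a common output space of arbitrary finite dimension. $\mathrm{CDP}_B$ is defined in the same way with the roles of $A$ and $B$ exchanged (the channels act on $B$). *)

theory Defs
  imports "Jordan_Normal_Form.Schur_Decomposition"
begin

text \<open>A Hilbert space of dimension \<open>d\<close> is \<open>carrier_vec d\<close> over the complex numbers, with the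
  library's inner product \<open>\<bullet>c\<close>; operators on it are the elements of \<open>carrier_mat d d\<close>.
  A tensor product of spaces of dimensions \<open>m\<close> and \<open>n\<close> is \<open>carrier_vec (m * n)\<close>, where the
  product basis vector \<open>(i, k)\<close> has index \<open>i * n + k\<close>.\<close>

definition mat_trace :: "complex mat \<Rightarrow> complex" where
  "mat_trace M = (\<Sum>i<dim_row M. M $$ (i, i))"

text \<open>The order on \<open>complex\<close> is the one where \<open>0 \<le> z\<close> means that \<open>z\<close> is real and nonnegative;
  hence Hermiticity is implied.\<close>

definition psd :: "nat \<Rightarrow> complex mat \<Rightarrow> bool" where
  "psd n M \<longleftrightarrow> M \<in> carrier_mat n n \<and> (\<forall>v\<in>carrier_vec n. 0 \<le> (M *\<^sub>v v) \<bullet>c v)"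

definition density_operator :: "nat \<Rightarrow> complex mat \<Rightarrow> bool" where
  "density_operator n \<rho> \<longleftrightarrow> psd n \<rho> \<and> mat_trace \<rho> = 1"

text \<open>The unique positive semidefinite square root of \<open>X\<^sup>\<dagger> X\<close>.\<close>

definition mat_abs :: "complex mat \<Rightarrow> complex mat" where
  "mat_abs X = (THE P. psd (dim_col X) P \<and> P * P = mat_adjoint X * X)"

definition trace_norm :: "complex mat \<Rightarrow> real" where
  "trace_norm X = Re (mat_trace (mat_abs X))"

definition trace_dist :: "complex mat \<Rightarrow> complex mat \<Rightarrow> real" where
  "trace_dist \<rho> \<sigma> = trace_norm (\<rho> - \<sigma>) / 2"

definition tensor_vec :: "complex vec \<Rightarrow> complex vec \<Rightarrow> complex vec" where
  "tensor_vec v w =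
     vec (dim_vec v * dim_vec w) (\<lambda>k. v $ (k div dim_vec w) * w $ (k mod dim_vec w))"

definition tensor_mat :: "complex mat \<Rightarrow> complex mat \<Rightarrow> complex mat" where
  "tensor_mat A B =
     mat (dim_row A * dim_row B) (dim_col A * dim_col B)
       (\<lambda>(r, c). A $$ (r div dim_row B, c div dim_col B) * B $$ (r mod dim_row B, c mod dim_col B))"

definition ket_bra :: "complex vec \<Rightarrow> complex mat" where
  "ket_bra \<psi> = mat (dim_vec \<psi>) (dim_vec \<psi>) (\<lambda>(r, c). \<psi> $ r * cnj (\<psi> $ c))"

text \<open>For a linear map \<open>\<Lambda>\<close> from \<open>m \<times> m\<close> to \<open>m' \<times> m'\<close> matrices, \<open>apply_fst m m' n \<Lambda>\<close> is
  \<open>\<Lambda> \<otimes> id\<close> and \<open>apply_snd n m m' \<Lambda>\<close> is \<open>id \<otimes> \<Lambda>\<close>, where the untouched factor has dimension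
  \<open>n\<close>. Writing \<open>M = (\<Sum>k l. M\<^bsub>kl\<^esub> \<otimes> E\<^bsub>kl\<^esub>)\<close> in terms of the matrix units \<open>E\<^bsub>kl\<^esub>\<close> of the
  untouched factor, each block \<open>M\<^bsub>kl\<^esub>\<close> is replaced by its image under \<open>\<Lambda>\<close> (and likewise with
  the factors exchanged).\<close>

definition apply_fst ::
  "nat \<Rightarrow> nat \<Rightarrow> nat \<Rightarrow> (complex mat \<Rightarrow> complex mat) \<Rightarrow> complex mat \<Rightarrow> complex mat" where
  "apply_fst m m' n \<Lambda> M =
     mat (m' * n) (m' * n)
       (\<lambda>(r, c). \<Lambda> (mat m m (\<lambda>(i, j). M $$ (i * n + r mod n, j * n + c mod n)))
                   $$ (r div n, c div n))"

definition apply_snd ::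
  "nat \<Rightarrow> nat \<Rightarrow> nat \<Rightarrow> (complex mat \<Rightarrow> complex mat) \<Rightarrow> complex mat \<Rightarrow> complex mat" where
  "apply_snd n m m' \<Lambda> M =
     mat (n * m') (n * m')
       (\<lambda>(r, c). \<Lambda> (mat m m (\<lambda>(i, j). M $$ ((r div m') * m + i, (c div m') * m + j)))
                   $$ (r mod m', c mod m'))"

definition linear_map :: "nat \<Rightarrow> nat \<Rightarrow> (complex mat \<Rightarrow> complex mat) \<Rightarrow> bool" where
  "linear_map m m' \<Lambda> \<longleftrightarrow>
     (\<forall>X\<in>carrier_mat m m. \<Lambda> X \<in> carrier_mat m' m') \<and>
     (\<forall>X\<in>carrier_mat m m. \<forall>Y\<in>carrier_mat m m. \<Lambda> (X + Y) = \<Lambda> X + \<Lambda> Y) \<and>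
     (\<forall>c. \<forall>X\<in>carrier_mat m m. \<Lambda> (c \<cdot>\<^sub>m X) = c \<cdot>\<^sub>m \<Lambda> X)"

definition completely_positive :: "nat \<Rightarrow> nat \<Rightarrow> (complex mat \<Rightarrow> complex mat) \<Rightarrow> bool" where
  "completely_positive m m' \<Lambda> \<longleftrightarrow>
     (\<forall>n M. psd (m * n) M \<longrightarrow> psd (m' * n) (apply_fst m m' n \<Lambda> M))"

definition trace_preserving :: "nat \<Rightarrow> (complex mat \<Rightarrow> complex mat) \<Rightarrow> bool" where
  "trace_preserving m \<Lambda> \<longleftrightarrow> (\<forall>X\<in>carrier_mat m m. mat_trace (\<Lambda> X) = mat_trace X)"

definition channel :: "nat \<Rightarrow> nat \<Rightarrow> (complex mat \<Rightarrow> complex mat) \<Rightarrow> bool" where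
  "channel m m' \<Lambda> \<longleftrightarrow> linear_map m m' \<Lambda> \<and> completely_positive m m' \<Lambda> \<and> trace_preserving m \<Lambda>"

text \<open>Values outside \<open>carrier_mat m m\<close> are irrelevant, so HOL inequality would be too coarse.\<close>

definition distinct_channels ::
  "nat \<Rightarrow> nat \<Rightarrow> (complex mat \<Rightarrow> complex mat) \<Rightarrow> (complex mat \<Rightarrow> complex mat) \<Rightarrow> bool" where
  "distinct_channels m m' \<Lambda>\<^sub>0 \<Lambda>\<^sub>1 \<longleftrightarrow>
     channel m m' \<Lambda>\<^sub>0 \<and> channel m m' \<Lambda>\<^sub>1 \<and> (\<exists>X\<in>carrier_mat m m. \<Lambda>\<^sub>0 X \<noteq> \<Lambda>\<^sub>1 X)"

text \<open>The supremum is a maximum, since the set of density operators is compact.\<close>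

definition diamond_dist ::
  "nat \<Rightarrow> nat \<Rightarrow> (complex mat \<Rightarrow> complex mat) \<Rightarrow> (complex mat \<Rightarrow> complex mat) \<Rightarrow> real" where
  "diamond_dist m m' \<Lambda>\<^sub>0 \<Lambda>\<^sub>1 =
     (SUP \<rho>\<in>{\<rho>. density_operator (m * m) \<rho>}.
        trace_dist (apply_fst m m' m \<Lambda>\<^sub>0 \<rho>) (apply_fst m m' m \<Lambda>\<^sub>1 \<rho>))"

definition CDP_A :: "nat \<Rightarrow> nat \<Rightarrow> complex mat \<Rightarrow> real" where
  "CDP_A dA dB \<rho> =
     Inf {trace_dist (apply_fst dA d dB \<Lambda>\<^sub>0 \<rho>) (apply_fst dA d dB \<Lambda>\<^sub>1 \<rho>) / diamond_dist dA d \<Lambda>\<^sub>0 \<Lambda>\<^sub>1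
          | d \<Lambda>\<^sub>0 \<Lambda>\<^sub>1. distinct_channels dA d \<Lambda>\<^sub>0 \<Lambda>\<^sub>1}"

definition CDP_B :: "nat \<Rightarrow> nat \<Rightarrow> complex mat \<Rightarrow> real" where
  "CDP_B dA dB \<rho> =
     Inf {trace_dist (apply_snd dA dB d \<Lambda>\<^sub>0 \<rho>) (apply_snd dA dB d \<Lambda>\<^sub>1 \<rho>) / diamond_dist dB d \<Lambda>\<^sub>0 \<Lambda>\<^sub>1
          | d \<Lambda>\<^sub>0 \<Lambda>\<^sub>1. distinct_channels dB d \<Lambda>\<^sub>0 \<Lambda>\<^sub>1}"

definition orthonormal_family :: "nat \<Rightarrow> nat set \<Rightarrow> (nat \<Rightarrow> complex vec) \<Rightarrow> bool" where
  "orthonormal_family d I a \<longleftrightarrow>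
     (\<forall>i\<in>I. a i \<in> carrier_vec d) \<and>
     (\<forall>i\<in>I. \<forall>j\<in>I. a i \<bullet>c a j = (if i = j then 1 else 0))"

text \<open>A Schmidt decomposition with \<open>r\<close> terms, indexed from \<open>1\<close>. Terms with vanishing coefficient
  are permitted, so \<open>r\<close> may exceed the Schmidt rank; coefficients beyond the \<open>r\<close>-th are \<open>0\<close>.\<close>

definition schmidt_decomposition ::
  "nat \<Rightarrow> nat \<Rightarrow> complex vec \<Rightarrow> nat \<Rightarrow> (nat \<Rightarrow> real) \<Rightarrow> (nat \<Rightarrow> complex vec) \<Rightarrow> (nat \<Rightarrow> complex vec)
     \<Rightarrow> bool" where
  "schmidt_decomposition dA dB \<psi> r p a b \<longleftrightarrow>
     r \<le> min dA dB \<and>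
     orthonormal_family dA {1..r} a \<and>
     orthonormal_family dB {1..r} b \<and>
     (\<forall>i\<in>{1..min dA dB}. 0 \<le> p i) \<and>
     (\<forall>i\<in>{r<..min dA dB}. p i = 0) \<and>
     (\<Sum>i\<in>{1..min dA dB}. p i) = 1 \<and>
     \<psi> = finsum_vec TYPE(complex) (dA * dB)
           (\<lambda>i. complex_of_real (sqrt (p i)) \<cdot>\<^sub>v tensor_vec (a i) (b i)) {1..r}"

lemma apply_fst_tensor:
  assumes L: "linear_map m m' \<Lambda>" and X: "X \<in> carrier_mat m m" and Y: "Y \<in> carrier_mat n n"
  shows "apply_fst m m' n \<Lambda> (tensor_mat X Y) = tensor_mat (\<Lambda> X) Y"
proof (rule eq_matI)
  have LX: "\<Lambda> X \<in> carrier_mat m' m'"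
    using L X by (auto simp: linear_map_def)
  then show "dim_row (apply_fst m m' n \<Lambda> (tensor_mat X Y)) = dim_row (tensor_mat (\<Lambda> X) Y)"
    and "dim_col (apply_fst m m' n \<Lambda> (tensor_mat X Y)) = dim_col (tensor_mat (\<Lambda> X) Y)"
    using Y by (auto simp: apply_fst_def tensor_mat_def)
  fix r c
  assume "r < dim_row (tensor_mat (\<Lambda> X) Y)" "c < dim_col (tensor_mat (\<Lambda> X) Y)"
  then have rc: "r < m' * n" "c < m' * n"
    using LX Y by (auto simp: tensor_mat_def)
  then have n: "0 < n" by (cases n) auto
  have rc': "r div n < m'" "c div n < m'" "r mod n < n" "c mod n < n"
    using rc n by (auto simp: less_mult_imp_div_less)
  have bnd: "i * n + k < m * n" if "i < m" "k < n" for i k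
  proof -
    have "i * n + k < Suc i * n" using that by simp
    also have "\<dots> \<le> m * n" using that by (intro mult_le_mono1) simp
    finally show ?thesis .
  qed
  have "mat m m (\<lambda>(i, j). tensor_mat X Y $$ (i * n + r mod n, j * n + c mod n))
        = Y $$ (r mod n, c mod n) \<cdot>\<^sub>m X"
    using X Y n rc' bnd by (intro eq_matI) (auto simp: tensor_mat_def)
  moreover have "\<Lambda> (Y $$ (r mod n, c mod n) \<cdot>\<^sub>m X) = Y $$ (r mod n, c mod n) \<cdot>\<^sub>m \<Lambda> X"
    using L X by (auto simp: linear_map_def)
  ultimately show "apply_fst m m' n \<Lambda> (tensor_mat X Y) $$ (r, c) = tensor_mat (\<Lambda> X) Y $$ (r, c)"
    using LX Y rc rc' by (auto simp: apply_fst_def tensor_mat_def)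
qed

lemma apply_snd_tensor:
  assumes L: "linear_map m m' \<Lambda>" and X: "X \<in> carrier_mat n n" and Y: "Y \<in> carrier_mat m m"
  shows "apply_snd n m m' \<Lambda> (tensor_mat X Y) = tensor_mat X (\<Lambda> Y)"
proof (rule eq_matI)
  have LY: "\<Lambda> Y \<in> carrier_mat m' m'"
    using L Y by (auto simp: linear_map_def)
  then show "dim_row (apply_snd n m m' \<Lambda> (tensor_mat X Y)) = dim_row (tensor_mat X (\<Lambda> Y))"
    and "dim_col (apply_snd n m m' \<Lambda> (tensor_mat X Y)) = dim_col (tensor_mat X (\<Lambda> Y))"
    using X by (auto simp: apply_snd_def tensor_mat_def)
  fix r c
  assume "r < dim_row (tensor_mat X (\<Lambda> Y))" "c < dim_col (tensor_mat X (\<Lambda> Y))"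
  then have rc: "r < n * m'" "c < n * m'"
    using LY X by (auto simp: tensor_mat_def)
  then have m': "0 < m'" by (cases m') auto
  have rc': "r div m' < n" "c div m' < n" "r mod m' < m'" "c mod m' < m'"
    using rc m' by (auto simp: less_mult_imp_div_less)
  have bnd: "k * m + i < n * m" if "i < m" "k < n" for i k
  proof -
    have "k * m + i < Suc k * m" using that by simp
    also have "\<dots> \<le> n * m" using that by (intro mult_le_mono1) simp
    finally show ?thesis .
  qed
  have "mat m m (\<lambda>(i, j). tensor_mat X Y $$ ((r div m') * m + i, (c div m') * m + j))
        = X $$ (r div m', c div m') \<cdot>\<^sub>m Y"
    using X Y rc' bnd by (intro eq_matI) (auto simp: tensor_mat_def)
  moreover have "\<Lambda> (X $$ (r div m', c div m') \<cdot>\<^sub>m Y) = X $$ (r div m', c div m') \<cdot>\<^sub>m \<Lambda> Y"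
    using L Y by (auto simp: linear_map_def)
  ultimately show "apply_snd n m m' \<Lambda> (tensor_mat X Y) $$ (r, c) = tensor_mat X (\<Lambda> Y) $$ (r, c)"
    using LY X rc rc' by (auto simp: apply_snd_def tensor_mat_def)
qed

end

theory Submission
  imports Defs "Jordan_Normal_Form.Spectral_Radius" "HOL-Analysis.L2_Norm"
begin

text \<open>Lower bound: if all Schmidt coefficients on \<open>A\<close> are positive, every vector \<open>\<phi>\<close> of
  \<open>A \<otimes> A'\<close> is \<open>(1 \<otimes> K) \<psi>\<close> with \<open>\<parallel>K\<parallel>\<^sup>2 \<le> \<parallel>\<phi>\<parallel>\<^sup>2 / p\<^bsub>min\<^esub>\<close>. As \<open>1 \<otimes> K\<close> commutes with maps on \<open>A\<close>,
  conjugation by it turns the output difference for \<open>\<psi>\<close> into that for \<open>\<phi>\<close> and increases the trace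
  norm at most by the factor \<open>1 / p\<^bsub>min\<^esub>\<close>; a spectral decomposition reduces mixed inputs to this
  case. Upper bound: for a unit vector \<open>e\<close> of \<open>A\<close>, a constant channel and the channel
  that reports whether the input is in the state \<open>e\<close> are perfectly distinguishable on \<open>e\<close>, but on
  \<open>\<psi>\<close> their distance is only \<open>\<langle>e, \<rho>\<^sub>A e\<rangle>\<close>; take \<open>e\<close> to be the last Schmidt vector, or a vector
  orthogonal to all of them if they do not span \<open>A\<close>. Exchanging the factors reduces \<open>B\<close> to \<open>A\<close>.\<close>

section \<open>Spectral theorem and positive semidefinite matrices\<close>

text \<open>The trace norm is defined by describing a square root, so no estimate is made on it
  directly. It is first identified with the sum of the absolute eigenvalues, then with the least
  total trace of a splitting \<open>X = P - N\<close> into positive parts. Conjugations and sums act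
  on such splittings term by term. The factor is exactly the inverse of the least Schmidt
  coefficient, without a dimension, because K is measured in Hilbert-Schmidt norm: it is assembled
  from the components of \<phi> along the Schmidt basis, whose squared norms add up to that of
  \<phi>; over the vectors composing a mixed input these add up to its trace 1. Suprema and
  quotients are total functions, so the diamond distance needs two more facts: the distances it
  ranges over are bounded, and it is positive for distinct channels. Both come from the maximally
  entangled state. It has full Schmidt rank, so the lower-bound argument also compares every input
  with it; and its image under a map lists the images of all matrix units.\<close>

lemma mat_adjoint_index [simp]:
  fixes A :: "complex mat"
  shows "i < dim_col A \<Longrightarrow> j < dim_row A \<Longrightarrow> mat_adjoint A $$ (i, j) = cnj (A $$ (j, i))"
    and "dim_row (mat_adjoint A) = dim_col A" and "dim_col (mat_adjoint A) = dim_row A"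
  by (auto simp: mat_adjoint_def mat_of_rows_def)

lemma mat_adjoint_carrier [simp, intro]:
  fixes A :: "complex mat"
  shows "A \<in> carrier_mat m n \<Longrightarrow> mat_adjoint A \<in> carrier_mat n m"
  by auto

lemma mult_mat_index:
  assumes "A \<in> carrier_mat m k" "B \<in> carrier_mat k n" "i < m" "j < n"
  shows "(A * B) $$ (i, j) = (\<Sum>l<k. A $$ (i, l) * B $$ (l, j))"
  using assms by (auto simp: scalar_prod_def lessThan_atLeast0 intro!: sum.cong)

lemma mat_adjoint_mult:
  fixes A B :: "complex mat"
  assumes "A \<in> carrier_mat m k" "B \<in> carrier_mat k n"
  shows "mat_adjoint (A * B) = mat_adjoint B * mat_adjoint A"
proof (rule eq_matI)
  fix i j assume "i < dim_row (mat_adjoint B * mat_adjoint A)" "j < dim_col (mat_adjoint B * mat_adjoint A)"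
  then have ij: "i < n" "j < m" using assms by auto
  have "mat_adjoint (A * B) $$ (i, j) = cnj (\<Sum>l<k. A $$ (j, l) * B $$ (l, i))"
    using assms ij by (subst mult_mat_index[symmetric, OF assms]) auto
  also have "\<dots> = (\<Sum>l<k. mat_adjoint B $$ (i, l) * mat_adjoint A $$ (l, j))"
    using assms ij by (auto simp: mult.commute intro!: sum.cong)
  also have "\<dots> = (mat_adjoint B * mat_adjoint A) $$ (i, j)"
    using assms ij by (intro mult_mat_index[symmetric]) auto
  finally show "mat_adjoint (A * B) $$ (i, j) = (mat_adjoint B * mat_adjoint A) $$ (i, j)" .
qed (use assms in auto)

section \<open>Diagonalization of Hermitian matrices by deflation\<close>

text \<open>Eigenvectors may be rescaled freely: the length is set to 1, and the phase makes the
  last coordinate real and nonpositive, as \<open>householder\<close> demands.\<close>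

lemma complex_eigenvector_exists:
  fixes X :: "complex mat"
  assumes X: "X \<in> carrier_mat (Suc n) (Suc n)"
  obtains v l where "(\<Sum>i\<le>n. v i * cnj (v i)) = 1" "v n = complex_of_real (- cmod (v n))"
    "\<And>i. i \<le> n \<Longrightarrow> (\<Sum>j\<le>n. X $$ (i, j) * v j) = l * v i"
proof -
  obtain l where "eigenvalue X l"
    using spectrum_non_empty[OF X] by (auto simp: spectrum_def)
  then obtain w where w: "w \<in> carrier_vec (Suc n)" "w \<noteq> 0\<^sub>v (Suc n)" "X *\<^sub>v w = l \<cdot>\<^sub>v w"
    using X by (auto simp: eigenvalue_def eigenvector_def)
  have ev: "(\<Sum>j\<le>n. X $$ (i, j) * w $ j) = l * w $ i" if "i \<le> n" for i
  proof -
    have "(\<Sum>j\<le>n. X $$ (i, j) * w $ j) = (X *\<^sub>v w) $ i"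
      using X w(1) that by (simp add: scalar_prod_def atLeastLessThanSuc_atLeastAtMost atLeast0AtMost)
    then show ?thesis using w that by simp
  qed
  define N where "N = sqrt (\<Sum>i\<le>n. (cmod (w $ i))\<^sup>2)"
  obtain k where k: "k \<le> n" "w $ k \<noteq> 0"
    using w by (metis carrier_vecD eq_vecI index_zero_vec(1,2) less_Suc_eq_le)
  have "0 < (cmod (w $ k))\<^sup>2" using k by simp
  also have "\<dots> \<le> (\<Sum>i\<le>n. (cmod (w $ i))\<^sup>2)" using k by (intro member_le_sum) auto
  finally have N: "N > 0" "N\<^sup>2 = (\<Sum>i\<le>n. (cmod (w $ i))\<^sup>2)" by (auto simp: N_def)
  \<comment> \<open>The phase that turns \<open>w $ n\<close> into minus its modulus; any phase will
    do if that coordinate is 0.\<close>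
  define ph where "ph = (if w $ n = 0 then 1 else - cnj (w $ n) / cmod (w $ n))"
  have ph: "cmod ph = 1" "ph * w $ n = complex_of_real (- cmod (w $ n))"
    by (auto simp: ph_def norm_divide power2_eq_square complex_norm_square[symmetric]
         simp del: of_real_mult)
       (metis complex_norm_square mult.commute nonzero_divide_eq_eq norm_eq_zero of_real_eq_0_iff power2_eq_square of_real_mult mult_cancel_left)
  define v where "v = (\<lambda>i. ph * w $ i / N)"
  have "(\<Sum>i\<le>n. v i * cnj (v i)) = complex_of_real (\<Sum>i\<le>n. (cmod (w $ i))\<^sup>2 / N\<^sup>2)"
    unfolding of_real_sum
  proof (rule sum.cong)
    fix i
    have "v i * cnj (v i) = complex_of_real ((cmod (v i))\<^sup>2)" using complex_norm_square by simp
    also have "cmod (v i) = cmod (w $ i) / N" using ph N by (simp add: v_def norm_mult norm_divide)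
    finally show "v i * cnj (v i) = complex_of_real ((cmod (w $ i))\<^sup>2 / N\<^sup>2)" by (simp add: power_divide)
  qed simp
  also have "(\<Sum>i\<le>n. (cmod (w $ i))\<^sup>2 / N\<^sup>2) = 1"
    using N(1) by (simp add: sum_divide_distrib[symmetric] N(2)[symmetric])
  finally have 1: "(\<Sum>i\<le>n. v i * cnj (v i)) = 1" by simp
  have 2: "v n = complex_of_real (- cmod (v n))"
    using ph N by (simp add: v_def norm_mult norm_divide)
  have 3: "(\<Sum>j\<le>n. X $$ (i, j) * v j) = l * v i" if "i \<le> n" for i
  proof -
    have "(\<Sum>j\<le>n. X $$ (i, j) * v j) = (\<Sum>j\<le>n. X $$ (i, j) * w $ j) * (ph / N)"
      unfolding sum_distrib_right by (auto simp: v_def intro!: sum.cong)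
    then show ?thesis using ev[OF that] by (simp add: v_def)
  qed
  show ?thesis using that 1 2 3 by blast
qed

text \<open>The sign convention on \<open>v n\<close> keeps the denominator of the Householder reflection away
  from zero.\<close>

lemma householder:
  assumes v: "(\<Sum>i\<le>n. v i * cnj (v i)) = 1" and vn: "v n = complex_of_real (- cmod (v n))"
  obtains H where "H \<in> carrier_mat (Suc n) (Suc n)" "mat_adjoint H = H" "H * H = 1\<^sub>m (Suc n)"
    "\<And>i. i \<le> n \<Longrightarrow> H $$ (i, n) = v i"
proof -
  \<comment> \<open>With w = e_n - v, the squared norm of w is 2 - 2 Re (v n) = 2 t. So H is the
    usual reflection 1 - 2 w w^dagger / |w|^2, which exchanges e_n and v.\<close>
  define t where "t = 1 + cmod (v n)"
  define w where "w = (\<lambda>i. (if i = n then 1 else 0) - v i)"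
  define H where "H = mat (Suc n) (Suc n) (\<lambda>(i, j). (if i = j then 1 else 0) - w i * cnj (w j) / t)"
  have t: "t > 0" by (simp add: t_def add_pos_nonneg)
  have cvn: "cnj (v n) = v n" by (metis complex_cnj_complex_of_real vn)
  have tv: "complex_of_real t = 1 - v n" by (subst vn) (simp add: t_def)
  have H: "H \<in> carrier_mat (Suc n) (Suc n)" by (simp add: H_def)
  have ww: "(\<Sum>i\<le>n. cnj (w i) * w i) = 2 * t"
  proof -
    have "(\<Sum>i\<le>n. cnj (w i) * w i)
        = (\<Sum>i\<le>n. ((if i = n then 1 - v n - cnj (v n) else 0) + v i * cnj (v i)))"
      by (intro sum.cong) (auto simp: w_def algebra_simps)
    also have "\<dots> = 2 * t" unfolding sum.distrib v by (simp add: cvn tv)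
    finally show ?thesis .
  qed
  have "H * H = 1\<^sub>m (Suc n)"
  proof (rule eq_matI)
    fix i j assume "i < dim_row (1\<^sub>m (Suc n))" "j < dim_col (1\<^sub>m (Suc n))"
    then have ij: "i \<le> n" "j \<le> n" by auto
    have "(H * H) $$ (i, j) = (\<Sum>k\<le>n. H $$ (i, k) * H $$ (k, j))"
      using H ij by (subst mult_mat_index[OF H H]) (auto simp: lessThan_Suc_atMost)
    also have "\<dots> = (\<Sum>k\<le>n. (if k = i then (if i = j then 1 else 0) - w i * cnj (w j) / t else 0)
        + (if k = j then - w i * cnj (w j) / t else 0) + (w i * cnj (w j) / t\<^sup>2) * (cnj (w k) * w k))"
      using ij t by (intro sum.cong) (auto simp: H_def field_simps power2_eq_square)
    also have "\<dots> = (if i = j then 1 else 0) - w i * cnj (w j) / t - w i * cnj (w j) / t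
        + (w i * cnj (w j) / t\<^sup>2) * (2 * t)"
      unfolding sum.distrib sum_distrib_left[symmetric] ww using ij by simp
    also have "\<dots> = (if i = j then 1 else 0)" using t by (simp add: field_simps power2_eq_square)
    finally show "(H * H) $$ (i, j) = 1\<^sub>m (Suc n) $$ (i, j)" using ij by simp
  qed (use H in auto)
  moreover have "mat_adjoint H = H" by (rule eq_matI) (auto simp: H_def)
  moreover have "H $$ (i, n) = v i" if "i \<le> n" for i
    using that t by (auto simp: H_def w_def cvn tv[symmetric] field_simps)
      (auto simp: tv field_simps)
  ultimately show ?thesis using that H by blast
qed

definition real_diag :: "nat \<Rightarrow> (nat \<Rightarrow> real) \<Rightarrow> complex mat" where
  "real_diag n l = mat n n (\<lambda>(i, j). if i = j then complex_of_real (l i) else 0)"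

lemma real_diag_carrier [simp, intro]: "real_diag n l \<in> carrier_mat n n"
  by (simp add: real_diag_def)

text \<open>Induction on the dimension. A reflection moves a unit eigenvector to the last basis
  vector; the last column then has only its diagonal entry, by Hermiticity so does the last row, and
  the hypothesis applies to the remaining block.\<close>

lemma hermitian_diagonalization:
  assumes "X \<in> carrier_mat n n" "mat_adjoint X = X"
  shows "\<exists>U l. U \<in> carrier_mat n n \<and> mat_adjoint U * U = 1\<^sub>m n \<and>
               X = U * real_diag n l * mat_adjoint U"
  using assms
proof (induction n arbitrary: X)
  case 0
  then show ?case by (intro exI[of _ "1\<^sub>m 0"] exI) (auto intro!: eq_matI)
next
  case (Suc n)
  let ?N = "Suc n"
  note X = Suc.prems(1)
  obtain v l where v: "(\<Sum>i\<le>n. v i * cnj (v i)) = 1" "v n = complex_of_real (- cmod (v n))"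
    and ev: "\<And>i. i \<le> n \<Longrightarrow> (\<Sum>j\<le>n. X $$ (i, j) * v j) = l * v i"
    using complex_eigenvector_exists[OF X] by blast
  obtain H where H: "H \<in> carrier_mat ?N ?N" and HA: "mat_adjoint H = H"
    and HH: "H * H = 1\<^sub>m ?N" and Hv: "\<And>i. i \<le> n \<Longrightarrow> H $$ (i, n) = v i"
    using householder[OF v] by blast
  \<comment> \<open>H is its own adjoint and its own inverse, so this is a unitary conjugation that
    preserves Hermiticity.\<close>
  define Y where "Y = H * (X * H)"
  have Y: "Y \<in> carrier_mat ?N ?N" using X H by (auto simp: Y_def)
  have YA: "mat_adjoint Y = Y"
    using X H Suc.prems(2) HA
    by (simp add: Y_def mat_adjoint_mult[of _ ?N ?N _ ?N] assoc_mult_mat[of _ ?N ?N _ ?N _ ?N])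
  have Ycol: "Y $$ (i, n) = (if i = n then l else 0)" if i: "i \<le> n" for i
  proof -
    have XH: "(X * H) $$ (k, n) = l * H $$ (k, n)" if "k \<le> n" for k
      using that X H ev[OF that] Hv
      by (subst mult_mat_index[OF X H]) (auto simp: lessThan_Suc_atMost)
    have "Y $$ (i, n) = (\<Sum>k\<le>n. H $$ (i, k) * (X * H) $$ (k, n))"
      unfolding Y_def using X H i by (subst mult_mat_index[of _ ?N ?N]) (auto simp: lessThan_Suc_atMost)
    also have "\<dots> = l * (\<Sum>k\<le>n. H $$ (i, k) * H $$ (k, n))"
      unfolding sum_distrib_left by (intro sum.cong) (auto simp: XH)
    also have "(\<Sum>k\<le>n. H $$ (i, k) * H $$ (k, n)) = (H * H) $$ (i, n)"
      using H i by (subst mult_mat_index[of _ ?N ?N]) (auto simp: lessThan_Suc_atMost)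
    finally show ?thesis using i by (simp add: HH)
  qed
  have Yc: "Y $$ (i, j) = cnj (Y $$ (j, i))" if "i \<le> n" "j \<le> n" for i j
    using that Y mat_adjoint_index(1)[of i Y j] by (simp add: YA)
  have Yrow: "Y $$ (n, i) = (if i = n then l else 0)" if i: "i \<le> n" for i
    using Yc[of n i] Yc[of n n] Ycol[OF i] Ycol[of n] i by auto
  have l: "l = complex_of_real (Re l)"
    using Yc[of n n] Ycol[of n] by (simp add: complex_eq_iff)
  define Y1 where "Y1 = mat n n (\<lambda>(i, j). Y $$ (i, j))"
  have "mat_adjoint Y1 = Y1"
    by (rule eq_matI) (auto simp: Y1_def Yc[symmetric])
  then obtain U1 l1 where U1: "U1 \<in> carrier_mat n n" "mat_adjoint U1 * U1 = 1\<^sub>m n"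
    and Y1: "Y1 = U1 * real_diag n l1 * mat_adjoint U1"
    using Suc.IH[of Y1] by (auto simp: Y1_def)
  \<comment> \<open>Block sum of the smaller unitary and the scalar 1; accordingly \<open>l2\<close>
    appends the new eigenvalue, real because it is a diagonal entry of a Hermitian matrix.\<close>
  define Z where "Z = mat ?N ?N (\<lambda>(i, j). if i < n \<and> j < n then U1 $$ (i, j) else if i = j then 1 else 0)"
  define l2 where "l2 = l1(n := Re l)"
  have Z: "Z \<in> carrier_mat ?N ?N" by (simp add: Z_def)
  have ZZ: "mat_adjoint Z * Z = 1\<^sub>m ?N"
  proof (rule eq_matI)
    fix i j assume "i < dim_row (1\<^sub>m ?N)" "j < dim_col (1\<^sub>m ?N)"
    then have ij: "i < ?N" "j < ?N" by auto
    have "(mat_adjoint Z * Z) $$ (i, j) = (\<Sum>k<n. cnj (Z $$ (k, i)) * Z $$ (k, j)) + cnj (Z $$ (n, i)) * Z $$ (n, j)"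
      using Z ij by (subst mult_mat_index[of _ ?N ?N]) auto
    also have "\<dots> = (if i = j then 1 else 0)"
    proof (cases "i < n \<and> j < n")
      case True
      have "(\<Sum>k<n. cnj (Z $$ (k, i)) * Z $$ (k, j)) = (mat_adjoint U1 * U1) $$ (i, j)"
        using True U1(1) by (subst mult_mat_index[of _ n n]) (auto simp: Z_def intro!: sum.cong)
      then show ?thesis using True by (simp add: U1(2) Z_def)
    next
      case False
      then show ?thesis using ij by (auto simp: Z_def)
    qed
    finally show "(mat_adjoint Z * Z) $$ (i, j) = 1\<^sub>m ?N $$ (i, j)" using ij by simp
  qed (use Z in auto)
  have diag: "(A * real_diag k d * mat_adjoint B) $$ (i, j)
      = (\<Sum>q<k. of_real (d q) * A $$ (i, q) * cnj (B $$ (j, q)))"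
    if "A \<in> carrier_mat k k" "B \<in> carrier_mat k k" "i < k" "j < k" for A B k d i j
  proof -
    have "(A * real_diag k d) $$ (i, q) = of_real (d q) * A $$ (i, q)" if "q < k" for q
    proof -
      have "(A * real_diag k d) $$ (i, q) = (\<Sum>s<k. if s = q then of_real (d q) * A $$ (i, q) else 0)"
        unfolding mult_mat_index[OF \<open>A \<in> _\<close> real_diag_carrier \<open>i < k\<close> that]
        by (rule sum.cong) (auto simp: real_diag_def that)
      then show ?thesis using that by simp
    qed
    then show ?thesis using that
      by (subst mult_mat_index[of _ k k]) (auto intro!: sum.cong)
  qed
  have YZ: "Y = Z * real_diag ?N l2 * mat_adjoint Z"
  proof (rule eq_matI)
    fix i j assume "i < dim_row (Z * real_diag ?N l2 * mat_adjoint Z)"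
      "j < dim_col (Z * real_diag ?N l2 * mat_adjoint Z)"
    then have ij: "i < ?N" "j < ?N" using Z by auto
    show "Y $$ (i, j) = (Z * real_diag ?N l2 * mat_adjoint Z) $$ (i, j)"
    proof (cases "i < n \<and> j < n")
      case True
      have "Y $$ (i, j) = Y1 $$ (i, j)" using True by (simp add: Y1_def)
      also have "\<dots> = (\<Sum>q<n. of_real (l1 q) * U1 $$ (i, q) * cnj (U1 $$ (j, q)))"
        unfolding Y1 by (rule diag) (use True U1(1) in auto)
      finally show ?thesis using True ij by (subst diag[OF Z Z]) (auto simp: Z_def l2_def)
    next
      case False
      then show ?thesis using ij Ycol[of i] Yrow[of j] l
        by (subst diag[OF Z Z]) (auto simp: Z_def l2_def)
    qed
  qed (use Y Z in auto)
  have "X = (H * H) * X * (H * H)" using X HH by simp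
  also have "\<dots> = H * Y * H"
    using X H by (simp add: Y_def assoc_mult_mat[of _ ?N ?N _ ?N _ ?N])
  also have "\<dots> = (H * Z) * real_diag ?N l2 * mat_adjoint (H * Z)"
    unfolding YZ using H Z HA mat_adjoint_carrier[OF Z]
    by (simp add: mat_adjoint_mult[of _ ?N ?N _ ?N] assoc_mult_mat[of _ ?N ?N _ ?N _ ?N] mult_carrier_mat[of _ ?N ?N _ ?N])
  finally have "X = (H * Z) * real_diag ?N l2 * mat_adjoint (H * Z)" .
  moreover have "mat_adjoint (H * Z) * (H * Z) = mat_adjoint Z * ((H * H) * Z)"
    using H Z HA by (simp add: mat_adjoint_mult[of _ ?N ?N _ ?N] assoc_mult_mat[of _ ?N ?N _ ?N _ ?N])
  ultimately show ?case using H Z HH ZZ by (intro exI[of _ "H * Z"] exI[of _ l2]) auto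
qed

text \<open>\<open>u i r\<close> is coordinate r of vector i. The second clause is the resolution of
  the identity, kept alongside orthonormality because sums over the basis are collapsed with
  it.\<close>

definition orthonormal_basis :: "nat \<Rightarrow> (nat \<Rightarrow> nat \<Rightarrow> complex) \<Rightarrow> bool" where
  "orthonormal_basis n u \<longleftrightarrow>
     (\<forall>i<n. \<forall>j<n. (\<Sum>r<n. u i r * cnj (u j r)) = (if i = j then 1 else 0)) \<and>
     (\<forall>r<n. \<forall>c<n. (\<Sum>i<n. u i r * cnj (u i c)) = (if r = c then 1 else 0))"

text \<open>A one-sided inverse of a square matrix is two-sided: n orthonormal vectors in dimension
  n are automatically complete.\<close>

lemma orthonormal_basisI:
  assumes "\<And>i j. i < n \<Longrightarrow> j < n \<Longrightarrow> (\<Sum>r<n. u i r * cnj (u j r)) = (if i = j then 1 else 0)"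
  shows "orthonormal_basis n u"
proof -
  define U where "U = mat n n (\<lambda>(i, r). u i r)"
  have U: "U \<in> carrier_mat n n" by (simp add: U_def)
  have "U * mat_adjoint U = 1\<^sub>m n"
  proof (rule eq_matI)
    fix i j assume "i < dim_row (1\<^sub>m n)" "j < dim_col (1\<^sub>m n)"
    then have ij: "i < n" "j < n" by auto
    have "(U * mat_adjoint U) $$ (i, j) = (\<Sum>r<n. U $$ (i, r) * mat_adjoint U $$ (r, j))"
      using U ij by (intro mult_mat_index) auto
    also have "\<dots> = (\<Sum>r<n. u i r * cnj (u j r))"
      using ij by (intro sum.cong) (auto simp: U_def)
    finally show "(U * mat_adjoint U) $$ (i, j) = 1\<^sub>m n $$ (i, j)" using assms ij by simp
  qed (use U in auto)
  then have UU: "mat_adjoint U * U = 1\<^sub>m n"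
    using mat_mult_left_right_inverse[of U n "mat_adjoint U"] U by auto
  have "(\<Sum>i<n. u i r * cnj (u i c)) = (if r = c then 1 else 0)" if rc: "r < n" "c < n" for r c
  proof -
    have "(\<Sum>i<n. u i r * cnj (u i c)) = (\<Sum>i<n. mat_adjoint U $$ (c, i) * U $$ (i, r))"
      using rc by (intro sum.cong) (auto simp: U_def)
    also have "\<dots> = (mat_adjoint U * U) $$ (c, r)"
      using U rc by (intro mult_mat_index[symmetric]) auto
    finally show ?thesis using rc by (auto simp: UU)
  qed
  then show ?thesis using assms by (simp add: orthonormal_basis_def)
qed

lemma hermitian_spectral:
  assumes X: "X \<in> carrier_mat n n" "mat_adjoint X = X"
  obtains u and l :: "nat \<Rightarrow> real" where "orthonormal_basis n u"
    "\<And>r c. r < n \<Longrightarrow> c < n \<Longrightarrow> X $$ (r, c) = (\<Sum>i<n. complex_of_real (l i) * u i r * cnj (u i c))"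
proof -
  obtain U l where U: "U \<in> carrier_mat n n" and UU: "mat_adjoint U * U = 1\<^sub>m n"
    and XU: "X = U * real_diag n l * mat_adjoint U"
    using hermitian_diagonalization[OF X] by blast
  define u where "u = (\<lambda>i r. U $$ (r, i))"
  have "orthonormal_basis n u"
  proof (rule orthonormal_basisI)
    fix i j assume ij: "i < n" "j < n"
    have "(\<Sum>r<n. u i r * cnj (u j r)) = (\<Sum>r<n. mat_adjoint U $$ (j, r) * U $$ (r, i))"
      using U ij by (intro sum.cong) (auto simp: u_def)
    also have "\<dots> = (mat_adjoint U * U) $$ (j, i)"
      using U ij by (intro mult_mat_index[symmetric]) auto
    finally show "(\<Sum>r<n. u i r * cnj (u j r)) = (if i = j then 1 else 0)"
      using ij by (auto simp: UU)
  qed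
  moreover have "X $$ (r, c) = (\<Sum>i<n. complex_of_real (l i) * u i r * cnj (u i c))"
    if rc: "r < n" "c < n" for r c
  proof -
    have "(U * real_diag n l) $$ (r, i) = complex_of_real (l i) * u i r" if "i < n" for i
    proof -
      have "(U * real_diag n l) $$ (r, i) = (\<Sum>s<n. if s = i then of_real (l i) * u i r else 0)"
        unfolding mult_mat_index[OF U real_diag_carrier \<open>r < n\<close> that]
        by (rule sum.cong) (auto simp: real_diag_def that u_def)
      then show ?thesis using that by simp
    qed
    moreover have "X $$ (r, c) = (\<Sum>i<n. (U * real_diag n l) $$ (r, i) * mat_adjoint U $$ (i, c))"
      unfolding XU using U rc by (intro mult_mat_index) auto
    ultimately show ?thesis using U rc by (auto simp: u_def intro!: sum.cong)
  qed
  ultimately show ?thesis using that by blast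
qed

section \<open>Quadratic forms and Gram decompositions of positive matrices\<close>

definition quad_form :: "nat \<Rightarrow> complex mat \<Rightarrow> (nat \<Rightarrow> complex) \<Rightarrow> complex" where
  "quad_form n M f = (\<Sum>r<n. \<Sum>c<n. cnj (f r) * M $$ (r, c) * f c)"

lemma quad_form_vec:
  assumes M: "M \<in> carrier_mat n n" and v: "v \<in> carrier_vec n"
  shows "(M *\<^sub>v v) \<bullet>c v = quad_form n M (($) v)"
proof -
  have "(M *\<^sub>v v) \<bullet>c v = (\<Sum>r<n. (\<Sum>c<n. M $$ (r, c) * v $ c) * cnj (v $ r))"
    using M v by (auto simp: scalar_prod_def lessThan_atLeast0 intro!: sum.cong)
  then show ?thesis
    by (simp add: quad_form_def sum_distrib_right sum_distrib_left mult_ac)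
qed

lemma psd_iff_quad_form:
  "psd n M \<longleftrightarrow> M \<in> carrier_mat n n \<and> (\<forall>f. 0 \<le> quad_form n M f)"
proof -
  have "quad_form n M f = quad_form n M (($) (vec n f))" for f
    by (auto simp: quad_form_def intro!: sum.cong)
  then show ?thesis
    unfolding psd_def using quad_form_vec by (metis vec_carrier)
qed

lemma psd_carrier: "psd n M \<Longrightarrow> M \<in> carrier_mat n n"
  by (simp add: psd_def)

text \<open>Polarization: the form is real on each e_i, hence real diagonal entries, and on each e_i
  + z e_j. The choice z = 1 relates the imaginary parts of the two mirrored entries, and z = i their
  real parts.\<close>

lemma psd_hermitian:
  assumes "psd n M" shows "mat_adjoint M = M"
proof -
  have M: "M \<in> carrier_mat n n" using assms by (rule psd_carrier)
  have q: "Im (quad_form n M f) = 0" for f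
    using assms by (auto simp: psd_iff_quad_form less_eq_complex_def)
  have diag: "Im (M $$ (i, i)) = 0" if "i < n" for i
  proof -
    have "quad_form n M (\<lambda>r. if r = i then 1 else 0)
        = (\<Sum>r<n. \<Sum>c<n. if r = i then (if c = i then M $$ (i, i) else 0) else 0)"
      unfolding quad_form_def by (intro sum.cong refl) auto
    also have "\<dots> = (\<Sum>r<n. if r = i then (\<Sum>c<n. if c = i then M $$ (i, i) else 0) else 0)"
      by (intro sum.cong refl) auto
    also have "\<dots> = M $$ (i, i)" using that by simp
    finally show ?thesis using q by metis
  qed
  have two: "Im (z * M $$ (i, j) + cnj z * M $$ (j, i)) = 0" if "i < n" "j < n" "i \<noteq> j" for i j z
  proof -
    have "quad_form n M (\<lambda>r. if r = i then 1 else if r = j then z else 0)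
        = (\<Sum>r<n. \<Sum>c<n. (if r = i then (if c = i then M $$ (i, i) else 0) + (if c = j then z * M $$ (i, j) else 0) else 0)
                + (if r = j then (if c = i then cnj z * M $$ (j, i) else 0) + (if c = j then cnj z * M $$ (j, j) * z else 0) else 0))"
      unfolding quad_form_def using \<open>i \<noteq> j\<close> by (intro sum.cong refl) auto
    also have "\<dots> = (\<Sum>r<n. (if r = i then (\<Sum>c<n. (if c = i then M $$ (i, i) else 0) + (if c = j then z * M $$ (i, j) else 0)) else 0)
                + (if r = j then (\<Sum>c<n. (if c = i then cnj z * M $$ (j, i) else 0) + (if c = j then cnj z * M $$ (j, j) * z else 0)) else 0))"
      by (intro sum.cong refl) (simp add: sum.distrib)
    also have "\<dots> = M $$ (i, i) + (z * M $$ (i, j) + cnj z * M $$ (j, i)) + (cnj z * z) * M $$ (j, j)"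
      using that by (simp add: sum.distrib)
    finally have "Im (M $$ (i, i) + (z * M $$ (i, j) + cnj z * M $$ (j, i)) + (cnj z * z) * M $$ (j, j)) = 0"
      using q by metis
    then show ?thesis using that by (simp add: diag)
  qed
  show ?thesis
  proof (rule eq_matI)
    fix i j assume "i < dim_row M" "j < dim_col M"
    then have ij: "i < n" "j < n" using M by auto
    have "cnj (M $$ (j, i)) = M $$ (i, j)"
    proof (cases "i = j")
      case True
      then show ?thesis using diag[of i] ij by (simp add: complex_eq_iff)
    next
      case False
      then show ?thesis using two[of i j 1] two[of i j \<i>] ij by (simp add: complex_eq_iff)
    qed
    then show "mat_adjoint M $$ (i, j) = M $$ (i, j)" using ij M by simp
  qed (use M in auto)
qed

lemma mult_cnj_norm: "z * cnj z = complex_of_real ((cmod z)\<^sup>2)"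
  by (rule complex_norm_square[symmetric])

lemma quad_form_rank_one_sum:
  assumes "\<And>r c. r < n \<Longrightarrow> c < n \<Longrightarrow> M $$ (r, c) = (\<Sum>j\<in>J. l j * w j r * cnj (w j c))"
  shows "quad_form n M f = (\<Sum>j\<in>J. l j * complex_of_real ((cmod (\<Sum>c<n. cnj (w j c) * f c))\<^sup>2))"
proof -
  have "quad_form n M f = (\<Sum>r<n. \<Sum>c<n. \<Sum>j\<in>J. l j * (cnj (f r) * w j r) * (cnj (w j c) * f c))"
    unfolding quad_form_def
    by (intro sum.cong refl) (simp add: assms sum_distrib_left sum_distrib_right mult_ac)
  also have "\<dots> = (\<Sum>j\<in>J. \<Sum>r<n. \<Sum>c<n. l j * (cnj (f r) * w j r) * (cnj (w j c) * f c))"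
    by (simp only: sum.swap[where B = J])
  also have "\<dots> = (\<Sum>j\<in>J. l j * ((\<Sum>r<n. cnj (f r) * w j r) * (\<Sum>c<n. cnj (w j c) * f c)))"
    by (simp add: sum_product sum_distrib_left mult_ac)
  also have "\<dots> = (\<Sum>j\<in>J. l j * complex_of_real ((cmod (\<Sum>c<n. cnj (w j c) * f c))\<^sup>2))"
  proof (intro sum.cong refl)
    fix j
    have "(\<Sum>r<n. cnj (f r) * w j r) = cnj (\<Sum>c<n. cnj (w j c) * f c)"
      by (simp add: mult.commute)
    then show "l j * ((\<Sum>r<n. cnj (f r) * w j r) * (\<Sum>c<n. cnj (w j c) * f c))
        = l j * complex_of_real ((cmod (\<Sum>c<n. cnj (w j c) * f c))\<^sup>2)"
      by (metis mult_cnj_norm mult.commute)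
  qed
  finally show ?thesis .
qed

lemma trace_rank_one_sum:
  assumes "M \<in> carrier_mat n n"
    and "\<And>r c. r < n \<Longrightarrow> c < n \<Longrightarrow> M $$ (r, c) = (\<Sum>j\<in>J. l j * w j r * cnj (w j c))"
  shows "mat_trace M = (\<Sum>j\<in>J. l j * complex_of_real (\<Sum>r<n. (cmod (w j r))\<^sup>2))"
proof -
  have "mat_trace M = (\<Sum>r<n. \<Sum>j\<in>J. l j * (w j r * cnj (w j r)))"
    using assms by (auto simp: mat_trace_def mult_ac)
  also have "\<dots> = (\<Sum>j\<in>J. l j * (\<Sum>r<n. w j r * cnj (w j r)))"
    by (subst sum.swap) (simp add: sum_distrib_left)
  finally show ?thesis by (simp add: mult_cnj_norm)
qed

text \<open>Each summand is a rank-one operator w_j w_j^dagger, whose quadratic form is a squared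
  modulus. Together with \<open>psd_gramE\<close> this reduces positivity to exhibiting vectors,
  which is how complete positivity is checked later.\<close>

lemma psd_gramI:
  assumes "M \<in> carrier_mat n n"
    and "\<And>r c. r < n \<Longrightarrow> c < n \<Longrightarrow> M $$ (r, c) = (\<Sum>j\<in>J. w j r * cnj (w j c))"
  shows "psd n M"
proof -
  have "quad_form n M f = (\<Sum>j\<in>J. 1 * complex_of_real ((cmod (\<Sum>c<n. cnj (w j c) * f c))\<^sup>2))" for f
    using assms(2) by (intro quad_form_rank_one_sum) simp
  then show ?thesis using assms(1)
    by (auto simp: psd_iff_quad_form less_eq_complex_def sum_nonneg simp flip: of_real_sum of_real_power)
qed

lemma psd_weighted_gramI:
  assumes "M \<in> carrier_mat n n" "\<And>j. j \<in> J \<Longrightarrow> 0 \<le> (l j :: real)"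
    and "\<And>r c. r < n \<Longrightarrow> c < n \<Longrightarrow> M $$ (r, c) = (\<Sum>j\<in>J. complex_of_real (l j) * w j r * cnj (w j c))"
  shows "psd n M"
proof (rule psd_gramI[where w = "\<lambda>j r. complex_of_real (sqrt (l j)) * w j r" and J = J])
  fix r c assume rc: "r < n" "c < n"
  show "M $$ (r, c) = (\<Sum>j\<in>J. complex_of_real (sqrt (l j)) * w j r * cnj (complex_of_real (sqrt (l j)) * w j c))"
    unfolding assms(3)[OF rc]
  proof (intro sum.cong refl)
    fix j assume "j \<in> J"
    then have "complex_of_real (l j) = complex_of_real (sqrt (l j)) * complex_of_real (sqrt (l j))"
      using assms(2) by (simp flip: of_real_mult)
    then show "complex_of_real (l j) * w j r * cnj (w j c)
      = complex_of_real (sqrt (l j)) * w j r * cnj (complex_of_real (sqrt (l j)) * w j c)"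
      by simp
  qed
qed (rule assms(1))

lemma orthonormal_basis_spectral_value:
  assumes u: "orthonormal_basis n u"
    and X: "\<And>r c. r < n \<Longrightarrow> c < n \<Longrightarrow> X $$ (r, c) = (\<Sum>i<n. complex_of_real (l i) * u i r * cnj (u i c))"
    and i: "i < n"
  shows "quad_form n X (u i) = complex_of_real (l i)"
    and "r < n \<Longrightarrow> (\<Sum>c<n. X $$ (r, c) * u i c) = complex_of_real (l i) * u i r"
proof -
  have on: "(\<Sum>c<n. cnj (u j c) * u i c) = (if i = j then 1 else 0)" if "j < n" for j
    using u i that by (simp add: orthonormal_basis_def mult.commute)
  have "quad_form n X (u i) = (\<Sum>j<n. if j = i then complex_of_real (l i) else 0)"
  proof -
    have "quad_form n X (u i)
        = (\<Sum>j<n. complex_of_real (l j) * complex_of_real ((cmod (\<Sum>c<n. cnj (u j c) * u i c))\<^sup>2))"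
      by (rule quad_form_rank_one_sum[OF X])
    also have "\<dots> = (\<Sum>j<n. if j = i then complex_of_real (l i) else 0)"
      by (intro sum.cong refl) (simp add: on)
    finally show ?thesis .
  qed
  then show "quad_form n X (u i) = complex_of_real (l i)" using i by simp
  show "(\<Sum>c<n. X $$ (r, c) * u i c) = complex_of_real (l i) * u i r" if "r < n"
  proof -
    have "(\<Sum>c<n. X $$ (r, c) * u i c)
        = (\<Sum>c<n. \<Sum>j<n. complex_of_real (l j) * u j r * (cnj (u j c) * u i c))"
      using that by (intro sum.cong) (auto simp: X sum_distrib_right sum_distrib_left mult_ac)
    also have "\<dots> = (\<Sum>j<n. complex_of_real (l j) * u j r * (\<Sum>c<n. cnj (u j c) * u i c))"
      by (subst sum.swap) (simp add: sum_distrib_left)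
    also have "\<dots> = (\<Sum>j<n. if j = i then complex_of_real (l i) * u i r else 0)"
      using on by (intro sum.cong) auto
    finally show ?thesis using i by simp
  qed
qed

text \<open>Eigenvectors scaled by the roots of their eigenvalues; an eigenvalue is nonnegative as
  the value of the form at its unit eigenvector.\<close>

lemma psd_gramE:
  assumes "psd n M"
  obtains w where "\<And>r c. r < n \<Longrightarrow> c < n \<Longrightarrow> M $$ (r, c) = (\<Sum>j<n. w j r * cnj (w j c))"
proof -
  obtain u l where u: "orthonormal_basis n u"
    and M: "\<And>r c. r < n \<Longrightarrow> c < n \<Longrightarrow> M $$ (r, c) = (\<Sum>i<n. complex_of_real (l i) * u i r * cnj (u i c))"
    using hermitian_spectral[OF psd_carrier[OF assms] psd_hermitian[OF assms]] by blast
  have l: "0 \<le> l i" if "i < n" for i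
  proof -
    have "0 \<le> quad_form n M (u i)" using assms by (simp add: psd_iff_quad_form)
    then show ?thesis
      using orthonormal_basis_spectral_value(1)[OF u M that] by (simp add: less_eq_complex_def)
  qed
  show ?thesis
  proof (rule that[of "\<lambda>j r. complex_of_real (sqrt (l j)) * u j r"])
    fix r c assume rc: "r < n" "c < n"
    show "M $$ (r, c) = (\<Sum>j<n. complex_of_real (sqrt (l j)) * u j r * cnj (complex_of_real (sqrt (l j)) * u j c))"
      unfolding M[OF rc]
    proof (intro sum.cong refl)
      fix j assume "j \<in> {..<n}"
      then have "complex_of_real (l j) = complex_of_real (sqrt (l j)) * complex_of_real (sqrt (l j))"
        using l by (simp flip: of_real_mult)
      then show "complex_of_real (l j) * u j r * cnj (u j c)
        = complex_of_real (sqrt (l j)) * u j r * cnj (complex_of_real (sqrt (l j)) * u j c)"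
        by simp
    qed
  qed
qed

text \<open>Basis independence of the trace: the completeness relation leaves only the diagonal
  entries.\<close>

lemma sum_quad_form_basis:
  assumes u: "orthonormal_basis n u" and M: "M \<in> carrier_mat n n"
  shows "(\<Sum>i<n. quad_form n M (u i)) = mat_trace M"
proof -
  have "(\<Sum>i<n. quad_form n M (u i)) = (\<Sum>r<n. \<Sum>c<n. M $$ (r, c) * (\<Sum>i<n. u i c * cnj (u i r)))"
  proof -
    have "(\<Sum>i<n. quad_form n M (u i)) = (\<Sum>r<n. \<Sum>i<n. \<Sum>c<n. cnj (u i r) * M $$ (r, c) * u i c)"
      unfolding quad_form_def by (rule sum.swap)
    also have "\<dots> = (\<Sum>r<n. \<Sum>c<n. \<Sum>i<n. cnj (u i r) * M $$ (r, c) * u i c)"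
      by (intro sum.cong[OF refl] sum.swap)
    finally show ?thesis by (simp add: sum_distrib_left mult_ac)
  qed
  also have "\<dots> = (\<Sum>r<n. \<Sum>c<n. if c = r then M $$ (r, r) else 0)"
    using u by (intro sum.cong refl) (auto simp: orthonormal_basis_def)
  also have "\<dots> = mat_trace M" using M by (auto simp: mat_trace_def)
  finally show ?thesis .
qed

section \<open>The trace norm of Hermitian matrices\<close>

text \<open>Squaring acts on the eigenvalues alone. Applied with eigenvalues \<open>l\<close> and
  with their absolute values it gives the same matrix, which is how the square root of X^2 is
  recognized.\<close>

lemma spectral_square:
  assumes u: "orthonormal_basis n u" and M: "M \<in> carrier_mat n n"
    and sp: "\<And>r c. r < n \<Longrightarrow> c < n \<Longrightarrow> M $$ (r, c) = (\<Sum>i<n. complex_of_real (l i) * u i r * cnj (u i c))"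
    and rc: "r < n" "c < n"
  shows "(M * M) $$ (r, c) = (\<Sum>i<n. complex_of_real ((l i)\<^sup>2) * u i r * cnj (u i c))"
proof -
  have "(M * M) $$ (r, c) = (\<Sum>k<n. \<Sum>i<n. complex_of_real (l i) * cnj (u i c) * (M $$ (r, k) * u i k))"
    unfolding mult_mat_index[OF M M rc] using rc
    by (intro sum.cong refl) (simp add: sp[of _ c] sum_distrib_left mult_ac)
  also have "\<dots> = (\<Sum>i<n. complex_of_real (l i) * cnj (u i c) * (\<Sum>k<n. M $$ (r, k) * u i k))"
    by (subst sum.swap) (simp add: sum_distrib_left)
  also have "\<dots> = (\<Sum>i<n. complex_of_real ((l i)\<^sup>2) * u i r * cnj (u i c))"
    using orthonormal_basis_spectral_value(2)[OF u sp] rc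
    by (intro sum.cong refl) (simp add: power2_eq_square mult_ac)
  finally show ?thesis .
qed

lemma quad_form_square:
  assumes P: "P \<in> carrier_mat n n" "mat_adjoint P = P"
  shows "quad_form n (P * P) f = (\<Sum>r<n. (\<Sum>c<n. P $$ (r, c) * f c) * cnj (\<Sum>c<n. P $$ (r, c) * f c))"
proof -
  have h: "P $$ (a, r) = cnj (P $$ (r, a))" if "a < n" "r < n" for a r
    using that P(1) mat_adjoint_index(1)[of a P r] by (simp add: P(2))
  have "quad_form n (P * P) f
      = (\<Sum>a<n. \<Sum>b<n. \<Sum>r<n. cnj (f a) * cnj (P $$ (r, a)) * (P $$ (r, b) * f b))"
    unfolding quad_form_def
    by (intro sum.cong refl)
       (simp add: mult_mat_index[OF P(1) P(1)] h[symmetric] sum_distrib_left sum_distrib_right mult_ac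
        del: index_mult_mat)
  also have "\<dots> = (\<Sum>a<n. \<Sum>r<n. \<Sum>b<n. cnj (f a) * cnj (P $$ (r, a)) * (P $$ (r, b) * f b))"
    by (intro sum.cong[OF refl] sum.swap)
  also have "\<dots> = (\<Sum>r<n. \<Sum>a<n. \<Sum>b<n. cnj (f a) * cnj (P $$ (r, a)) * (P $$ (r, b) * f b))"
    by (rule sum.swap)
  also have "\<dots> = (\<Sum>r<n. (\<Sum>a<n. cnj (f a) * cnj (P $$ (r, a))) * (\<Sum>b<n. P $$ (r, b) * f b))"
    by (simp add: sum_product)
  finally show ?thesis by (simp add: mult.commute)
qed

lemma psd_diff_hermitian:
  assumes "psd n P" "psd n N"
  shows "P - N \<in> carrier_mat n n" "mat_adjoint (P - N) = P - N"
proof -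
  note Pc = psd_carrier[OF assms(1)] and Ph = psd_hermitian[OF assms(1)]
  note Nc = psd_carrier[OF assms(2)] and Nh = psd_hermitian[OF assms(2)]
  show D: "P - N \<in> carrier_mat n n" using Pc Nc by auto
  show "mat_adjoint (P - N) = P - N"
  proof (rule eq_matI)
    fix i j assume "i < dim_row (P - N)" "j < dim_col (P - N)"
    then have ij: "i < n" "j < n" using D by auto
    have "cnj (P $$ (j, i)) = P $$ (i, j)" "cnj (N $$ (j, i)) = N $$ (i, j)"
      using ij Pc Nc mat_adjoint_index(1)[of i P j] mat_adjoint_index(1)[of i N j]
      by (simp_all add: Ph Nh)
    then show "mat_adjoint (P - N) $$ (i, j) = (P - N) $$ (i, j)" using ij Pc Nc by simp
  qed (use Pc Nc in auto)
qed

text \<open>If \<open>u\<close> is a unit eigenvector of \<open>P - Q\<close> with eigenvalue \<open>\<lambda>\<close>, then \<open>\<parallel>P u\<parallel> = \<parallel>Q u\<parallel>\<close> gives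
  \<open>\<lambda> (\<langle>u, P u\<rangle> + \<langle>u, Q u\<rangle>) = 0\<close>, and if \<open>\<lambda> \<noteq> 0\<close> then both summands vanish, hence so does
  their difference \<open>\<lambda>\<close>.\<close>

lemma psd_sqrt_unique:
  assumes P: "psd n P" and Q: "psd n Q" and eq: "P * P = Q * Q"
  shows "P = Q"
proof -
  note Pc = psd_carrier[OF P] and Ph = psd_hermitian[OF P]
  note Qc = psd_carrier[OF Q] and Qh = psd_hermitian[OF Q]
  define D where "D = P - Q"
  note D = psd_diff_hermitian[OF P Q, folded D_def]
  obtain u l where u: "orthonormal_basis n u"
    and sp: "\<And>r c. r < n \<Longrightarrow> c < n \<Longrightarrow> D $$ (r, c) = (\<Sum>i<n. complex_of_real (l i) * u i r * cnj (u i c))"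
    using hermitian_spectral[OF D] by blast
  have "l i = 0" if i: "i < n" for i
  proof (rule ccontr)
    assume l: "l i \<noteq> 0"
    define p where "p = (\<lambda>r. \<Sum>c<n. P $$ (r, c) * u i c)"
    define q where "q = (\<lambda>r. \<Sum>c<n. Q $$ (r, c) * u i c)"
    have qP: "quad_form n P (u i) = (\<Sum>r<n. cnj (u i r) * p r)"
      by (simp add: quad_form_def p_def sum_distrib_left mult_ac)
    have qQ: "quad_form n Q (u i) = (\<Sum>r<n. cnj (u i r) * q r)"
      by (simp add: quad_form_def q_def sum_distrib_left mult_ac)
    have pq: "p r = q r + l i * u i r" if r: "r < n" for r
    proof -
      have "(\<Sum>c<n. D $$ (r, c) * u i c) = p r - q r"
        using r Pc Qc by (simp add: D_def p_def q_def left_diff_distrib sum_subtractf)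
      then show ?thesis using orthonormal_basis_spectral_value(2)[OF u sp i r] by (simp add: algebra_simps)
    qed
    have on: "(\<Sum>r<n. u i r * cnj (u i r)) = 1" using u i by (simp add: orthonormal_basis_def)
    have qPQ: "quad_form n P (u i) = quad_form n Q (u i) + l i"
    proof -
      have "quad_form n P (u i) = (\<Sum>r<n. cnj (u i r) * q r + l i * (u i r * cnj (u i r)))"
        unfolding qP by (intro sum.cong refl) (simp add: pq algebra_simps)
      then show ?thesis by (simp add: sum.distrib qQ on flip: sum_distrib_left)
    qed
    have Im: "Im (quad_form n Q (u i)) = 0" "0 \<le> Re (quad_form n Q (u i))" "0 \<le> Re (quad_form n P (u i))"
      using P Q by (auto simp: psd_iff_quad_form less_eq_complex_def)
    have "(\<Sum>r<n. p r * cnj (p r)) = (\<Sum>r<n. q r * cnj (q r))"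
      using quad_form_square[OF Pc Ph, of "u i"] quad_form_square[OF Qc Qh, of "u i"] eq
      by (simp add: p_def q_def)
    also have "(\<Sum>r<n. p r * cnj (p r)) = (\<Sum>r<n. q r * cnj (q r) + l i * (cnj (u i r) * q r)
        + l i * cnj (cnj (u i r) * q r) + (l i)\<^sup>2 * (u i r * cnj (u i r)))"
      by (intro sum.cong refl) (simp add: pq algebra_simps power2_eq_square)
    also have "\<dots> = (\<Sum>r<n. q r * cnj (q r)) + l i * quad_form n Q (u i)
        + l i * cnj (quad_form n Q (u i)) + (l i)\<^sup>2"
      unfolding sum.distrib sum_distrib_left[symmetric] on qQ by simp
    finally have "l i * (quad_form n Q (u i) + cnj (quad_form n Q (u i)) + l i) = 0"
      by (simp add: algebra_simps power2_eq_square)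
    then have "quad_form n Q (u i) + cnj (quad_form n Q (u i)) + l i = 0" using l by simp
    then have "Re (quad_form n Q (u i)) + Re (quad_form n P (u i)) = 0"
      using qPQ by (simp add: complex_eq_iff)
    then have "Re (quad_form n Q (u i)) = 0" "Re (quad_form n P (u i)) = 0" using Im by linarith+
    then show False using qPQ l by simp
  qed
  then have "D $$ (r, c) = 0" if "r < n" "c < n" for r c using that by (simp add: sp)
  then show ?thesis using Pc Qc by (intro eq_matI) (auto simp: D_def)
qed

text \<open>The matrix with the same eigenvectors and the absolute eigenvalues is a positive root of
  X^dagger X, and \<open>psd_sqrt_unique\<close> shows that the definite description in
  \<open>mat_abs\<close> denotes it.\<close>

lemma trace_norm_spectral:
  assumes X: "X \<in> carrier_mat n n" "mat_adjoint X = X" and u: "orthonormal_basis n u"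
    and sp: "\<And>r c. r < n \<Longrightarrow> c < n \<Longrightarrow> X $$ (r, c) = (\<Sum>i<n. complex_of_real (l i) * u i r * cnj (u i c))"
  shows "trace_norm X = (\<Sum>i<n. \<bar>l i\<bar>)"
proof -
  define Q where "Q = mat n n (\<lambda>(r, c). \<Sum>i<n. complex_of_real \<bar>l i\<bar> * u i r * cnj (u i c))"
  have Q: "Q \<in> carrier_mat n n" by (simp add: Q_def)
  have Qsp: "Q $$ (r, c) = (\<Sum>i<n. complex_of_real \<bar>l i\<bar> * u i r * cnj (u i c))" if "r < n" "c < n" for r c
    using that by (simp add: Q_def)
  have pQ: "psd n Q" by (rule psd_weighted_gramI[OF Q _ Qsp]) auto
  have QQ: "Q * Q = mat_adjoint X * X"
  proof (rule eq_matI)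
    fix i j assume "i < dim_row (mat_adjoint X * X)" "j < dim_col (mat_adjoint X * X)"
    then have ij: "i < n" "j < n" using X by auto
    have "(X * X) $$ (i, j) = (\<Sum>k<n. complex_of_real ((l k)\<^sup>2) * u k i * cnj (u k j))"
      by (rule spectral_square[OF u X(1) _ ij, of l]) (rule sp)
    moreover have "(Q * Q) $$ (i, j) = (\<Sum>k<n. complex_of_real (\<bar>l k\<bar>\<^sup>2) * u k i * cnj (u k j))"
      by (rule spectral_square[OF u Q _ ij, of "\<lambda>k. \<bar>l k\<bar>"]) (rule Qsp)
    ultimately show "(Q * Q) $$ (i, j) = (mat_adjoint X * X) $$ (i, j)"
      unfolding X(2) by (simp only: power2_abs)
  qed (use X Q in auto)
  have "mat_abs X = Q"
    unfolding mat_abs_def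
  proof (rule the_equality)
    show "psd (dim_col X) Q \<and> Q * Q = mat_adjoint X * X" using pQ QQ X by simp
  next
    fix P assume "psd (dim_col X) P \<and> P * P = mat_adjoint X * X"
    then show "P = Q" using psd_sqrt_unique[of n P Q] pQ QQ X by simp
  qed
  moreover have "mat_trace Q = (\<Sum>i<n. complex_of_real \<bar>l i\<bar>)"
    unfolding sum_quad_form_basis[OF u Q, symmetric]
    by (intro sum.cong refl) (simp add: orthonormal_basis_spectral_value(1)[OF u Qsp])
  ultimately show ?thesis by (simp add: trace_norm_def)
qed

text \<open>The variational description of the trace norm of a Hermitian matrix: it is the least \<open>t\<close>
  with \<open>trace_split n X t\<close>.\<close>

definition trace_split :: "nat \<Rightarrow> complex mat \<Rightarrow> real \<Rightarrow> bool" where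
  "trace_split n X t \<longleftrightarrow>
     (\<exists>P N. psd n P \<and> psd n N \<and> X = P - N \<and> Re (mat_trace P) + Re (mat_trace N) \<le> t)"

text \<open>In an eigenbasis of X each eigenvalue is the difference of the nonnegative forms of P
  and N, hence bounded in modulus by their sum; summing over the basis gives the two traces.\<close>

lemma trace_norm_le:
  assumes "trace_split n X t"
  shows "trace_norm X \<le> t"
proof -
  obtain P N where P: "psd n P" and N: "psd n N" and X: "X = P - N"
    and t: "Re (mat_trace P) + Re (mat_trace N) \<le> t"
    using assms by (auto simp: trace_split_def)
  note XH = psd_diff_hermitian[OF P N, folded X]
  obtain u l where u: "orthonormal_basis n u"
    and sp: "\<And>r c. r < n \<Longrightarrow> c < n \<Longrightarrow> X $$ (r, c) = (\<Sum>i<n. complex_of_real (l i) * u i r * cnj (u i c))"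
    using hermitian_spectral[OF XH] by blast
  have "\<bar>l i\<bar> \<le> Re (quad_form n P (u i)) + Re (quad_form n N (u i))" if i: "i < n" for i
  proof -
    have "quad_form n X (u i) = quad_form n P (u i) - quad_form n N (u i)"
      using psd_carrier[OF P] psd_carrier[OF N]
      by (simp add: quad_form_def X algebra_simps sum_subtractf)
    then have "l i = Re (quad_form n P (u i)) - Re (quad_form n N (u i))"
      using orthonormal_basis_spectral_value(1)[OF u sp i] by (simp add: complex_eq_iff)
    moreover have "0 \<le> Re (quad_form n P (u i))" "0 \<le> Re (quad_form n N (u i))"
      using P N by (auto simp: psd_iff_quad_form less_eq_complex_def)
    ultimately show ?thesis by linarith
  qed
  then have "(\<Sum>i<n. \<bar>l i\<bar>) \<le> (\<Sum>i<n. Re (quad_form n P (u i)) + Re (quad_form n N (u i)))"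
    by (intro sum_mono) auto
  also have "\<dots> = Re (mat_trace P) + Re (mat_trace N)"
    using sum_quad_form_basis[OF u psd_carrier[OF P]] sum_quad_form_basis[OF u psd_carrier[OF N]]
    by (simp add: sum.distrib flip: Re_sum)
  finally show ?thesis using t trace_norm_spectral[OF XH u sp] by simp
qed

text \<open>The Jordan decomposition attains the minimum: P and N carry the positive and negative
  parts of the eigenvalues.\<close>

lemma trace_split_trace_norm:
  assumes "psd n A" "psd n B"
  shows "trace_split n (A - B) (trace_norm (A - B))"
proof -
  define X where "X = A - B"
  note XH = psd_diff_hermitian[OF assms, folded X_def]
  obtain u l where u: "orthonormal_basis n u"
    and sp: "\<And>r c. r < n \<Longrightarrow> c < n \<Longrightarrow> X $$ (r, c) = (\<Sum>i<n. complex_of_real (l i) * u i r * cnj (u i c))"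
    using hermitian_spectral[OF XH] by blast
  \<comment> \<open>\<open>W k\<close> keeps the eigenvectors of X and replaces its eigenvalues by
    \<open>k\<close>.\<close>
  define W where "W = (\<lambda>k. mat n n (\<lambda>(r, c). \<Sum>i<n. complex_of_real (k i) * u i r * cnj (u i c)))"
  have W: "W k \<in> carrier_mat n n" for k by (simp add: W_def)
  have Wsp: "W k $$ (r, c) = (\<Sum>i<n. complex_of_real (k i) * u i r * cnj (u i c))" if "r < n" "c < n" for r c k
    using that by (simp add: W_def)
  have Wpsd: "psd n (W k)" if "\<And>i. 0 \<le> k i" for k by (rule psd_weighted_gramI[OF W _ Wsp]) (rule that)
  have Wtr: "Re (mat_trace (W k)) = (\<Sum>i<n. k i)" for k
    unfolding sum_quad_form_basis[OF u W, symmetric] Re_sum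
    by (intro sum.cong refl) (simp add: orthonormal_basis_spectral_value(1)[OF u Wsp])
  have "X = W (\<lambda>i. max (l i) 0) - W (\<lambda>i. max (- l i) 0)"
  proof (rule eq_matI)
    fix r c assume "r < dim_row (W (\<lambda>i. max (l i) 0) - W (\<lambda>i. max (- l i) 0))"
      "c < dim_col (W (\<lambda>i. max (l i) 0) - W (\<lambda>i. max (- l i) 0))"
    then have rc: "r < n" "c < n" by (auto simp: W_def)
    have "X $$ (r, c) = (\<Sum>i<n. complex_of_real (max (l i) 0) * u i r * cnj (u i c))
        - (\<Sum>i<n. complex_of_real (max (- l i) 0) * u i r * cnj (u i c))"
    proof -
      have pos_neg: "complex_of_real (l i) = complex_of_real (max (l i) 0) - complex_of_real (max (- l i) 0)" for i
        by (cases "0 \<le> l i") auto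
      show ?thesis
        unfolding sp[OF rc] sum_subtractf[symmetric]
        by (intro sum.cong refl) (simp only: pos_neg[symmetric] left_diff_distrib[symmetric])
    qed
    then show "X $$ (r, c) = (W (\<lambda>i. max (l i) 0) - W (\<lambda>i. max (- l i) 0)) $$ (r, c)"
      using rc by (simp add: W_def)
  qed (use XH W in \<open>auto simp: W_def\<close>)
  moreover have "(\<Sum>i<n. max (l i) 0) + (\<Sum>i<n. max (- l i) 0) = (\<Sum>i<n. \<bar>l i\<bar>)"
    unfolding sum.distrib[symmetric] by (intro sum.cong refl) auto
  ultimately have "psd n (W (\<lambda>i. max (l i) 0)) \<and> psd n (W (\<lambda>i. max (- l i) 0)) \<and>
      X = W (\<lambda>i. max (l i) 0) - W (\<lambda>i. max (- l i) 0) \<and>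
      Re (mat_trace (W (\<lambda>i. max (l i) 0))) + Re (mat_trace (W (\<lambda>i. max (- l i) 0))) \<le> trace_norm X"
    using trace_norm_spectral[OF XH u sp] by (simp add: Wtr Wpsd)
  then show ?thesis unfolding trace_split_def X_def[symmetric] by blast
qed

lemma trace_norm_nonneg:
  assumes "psd n A" "psd n B"
  shows "0 \<le> trace_norm (A - B)"
proof -
  note XH = psd_diff_hermitian[OF assms]
  obtain u l where "orthonormal_basis n u"
    "\<And>r c. r < n \<Longrightarrow> c < n \<Longrightarrow> (A - B) $$ (r, c) = (\<Sum>i<n. complex_of_real (l i) * u i r * cnj (u i c))"
    using hermitian_spectral[OF XH] by blast
  from trace_norm_spectral[OF XH this] show ?thesis by (simp add: sum_nonneg)
qed

text \<open>A lower bound for the trace norm that requires no eigenvalues: diagonal entries of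
  positive matrices are nonnegative, so the modulus of an entry of P - N is at most the sum of the
  two.\<close>

lemma trace_split_diagonal:
  assumes "trace_split n X t"
  shows "(\<Sum>r<n. cmod (X $$ (r, r))) \<le> t"
proof -
  obtain P N where P: "psd n P" and N: "psd n N" and X: "X = P - N"
    and t: "Re (mat_trace P) + Re (mat_trace N) \<le> t"
    using assms by (auto simp: trace_split_def)
  have diag: "cmod (M $$ (r, r)) = Re (M $$ (r, r))" if M: "psd n M" and r: "r < n" for M r
  proof -
    obtain w where "M $$ (r, r) = (\<Sum>j<n. w j r * cnj (w j r))" using psd_gramE[OF M] r by metis
    then have "M $$ (r, r) = complex_of_real (\<Sum>j<n. (cmod (w j r))\<^sup>2)" by (simp add: mult_cnj_norm)
    moreover have "0 \<le> (\<Sum>j<n. (cmod (w j r))\<^sup>2)" by (simp add: sum_nonneg)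
    ultimately show ?thesis by (metis Re_complex_of_real abs_of_nonneg norm_of_real)
  qed
  have "(\<Sum>r<n. cmod (X $$ (r, r))) \<le> (\<Sum>r<n. Re (P $$ (r, r)) + Re (N $$ (r, r)))"
  proof (rule sum_mono)
    fix r assume "r \<in> {..<n}"
    then show "cmod (X $$ (r, r)) \<le> Re (P $$ (r, r)) + Re (N $$ (r, r))"
      using psd_carrier[OF P] psd_carrier[OF N] norm_triangle_ineq4[of "P $$ (r, r)" "N $$ (r, r)"]
      by (simp add: X diag[OF P] diag[OF N])
  qed
  also have "\<dots> = Re (mat_trace P) + Re (mat_trace N)"
    using psd_carrier[OF P] psd_carrier[OF N] by (simp add: mat_trace_def sum.distrib)
  finally show ?thesis using t by simp
qed

section \<open>Product indices, and splittings under conjugation and sums\<close>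

lemma sum_prod_index:
  fixes f :: "nat \<Rightarrow> 'a::comm_monoid_add"
  shows "(\<Sum>r<m * n. f r) = (\<Sum>i<m. \<Sum>k<n. f (i * n + k))"
proof (induction m)
  case (Suc m)
  have "(\<Sum>r<Suc m * n. f r) = (\<Sum>r<m * n. f r) + (\<Sum>k<n. f (m * n + k))"
    using sum.nat_group[of f n 1] sum.atLeastLessThan_concat[of 0 "m * n" "m * n + n" f]
      sum.shift_bounds_nat_ivl[of f 0 "m * n" n]
    by (simp add: lessThan_atLeast0 add.commute)
  then show ?case using Suc by simp
qed simp

lemma prod_index_less: "i < m \<Longrightarrow> k < n \<Longrightarrow> i * n + k < m * (n :: nat)"
  by (metis add.commute div_mult_self3 div_less less_nat_zero_code add.right_neutral
      div_less_iff_less_mult gr_zeroI)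

lemma prod_index_cases:
  assumes "r < m * (n :: nat)"
  obtains i k where "r = i * n + k" "i < m" "k < n"
proof -
  have "n > 0" using assms by (cases n) auto
  then show ?thesis
    using that[of "r div n" "r mod n"] assms by (simp add: less_mult_imp_div_less)
qed

text \<open>P' is V P V^dagger, and the estimate on V says that its squared operator norm is at most
  C. Applying V to the Gram vectors of P gives Gram vectors of P', and the trace is the sum of their
  squared norms.\<close>

lemma psd_conj:
  assumes P: "psd n P" and C: "0 \<le> C"
    and V: "\<And>f. (\<Sum>r<n'. (cmod (\<Sum>s<n. V r s * f s))\<^sup>2) \<le> C * (\<Sum>s<n. (cmod (f s))\<^sup>2)"
  defines "P' \<equiv> mat n' n' (\<lambda>(r, c). \<Sum>s<n. \<Sum>t<n. V r s * P $$ (s, t) * cnj (V c t))"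
  shows "psd n' P'" and "Re (mat_trace P') \<le> C * Re (mat_trace P)"
proof -
  obtain w where w: "\<And>r c. r < n \<Longrightarrow> c < n \<Longrightarrow> P $$ (r, c) = (\<Sum>j<n. w j r * cnj (w j c))"
    using psd_gramE[OF P] by blast
  define w' where "w' = (\<lambda>j r. \<Sum>s<n. V r s * w j s)"
  have c: "P' \<in> carrier_mat n' n'" by (simp add: P'_def)
  have P': "P' $$ (r, c) = (\<Sum>j<n. w' j r * cnj (w' j c))" if "r < n'" "c < n'" for r c
  proof -
    have "P' $$ (r, c) = (\<Sum>s<n. \<Sum>t<n. \<Sum>j<n. (V r s * w j s) * cnj (V c t * w j t))"
      using that unfolding P'_def by (auto simp: w sum_distrib_left sum_distrib_right mult_ac intro!: sum.cong)
    also have "\<dots> = (\<Sum>s<n. \<Sum>j<n. \<Sum>t<n. (V r s * w j s) * cnj (V c t * w j t))"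
      by (intro sum.cong[OF refl] sum.swap)
    also have "\<dots> = (\<Sum>j<n. \<Sum>s<n. \<Sum>t<n. (V r s * w j s) * cnj (V c t * w j t))"
      by (rule sum.swap)
    finally show ?thesis by (simp add: w'_def sum_product)
  qed
  show "psd n' P'" by (rule psd_gramI[OF c P'])
  have tr: "mat_trace M = complex_of_real (\<Sum>j<n. \<Sum>r<k. (cmod (v j r))\<^sup>2)"
    if "M \<in> carrier_mat k k" "\<And>r c. r < k \<Longrightarrow> c < k \<Longrightarrow> M $$ (r, c) = (\<Sum>j<n. v j r * cnj (v j c))"
    for M k v
    using trace_rank_one_sum[OF that(1), where J = "{..<n}" and l = "\<lambda>_. 1" and w = v] that(2) by simp
  have "Re (mat_trace P') = (\<Sum>j<n. \<Sum>r<n'. (cmod (w' j r))\<^sup>2)"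
    by (subst tr[OF c P']) auto
  also have "\<dots> \<le> (\<Sum>j<n. C * (\<Sum>s<n. (cmod (w j s))\<^sup>2))"
    unfolding w'_def by (intro sum_mono V)
  also have "\<dots> = C * Re (mat_trace P)"
    by (subst tr[OF psd_carrier[OF P] w]) (auto simp: sum_distrib_left)
  finally show "Re (mat_trace P') \<le> C * Re (mat_trace P)" .
qed

text \<open>Conjugating P and N separately keeps a splitting: this is the inequality |V X
  V^dagger|_1 <= |V|^2 |X|_1.\<close>

lemma trace_split_conj:
  assumes X: "trace_split n X t" and Y: "Y \<in> carrier_mat n' n'" and C: "0 \<le> C"
    and YX: "\<And>r c. r < n' \<Longrightarrow> c < n' \<Longrightarrow> Y $$ (r, c) = (\<Sum>s<n. \<Sum>t<n. V r s * X $$ (s, t) * cnj (V c t))"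
    and V: "\<And>f. (\<Sum>r<n'. (cmod (\<Sum>s<n. V r s * f s))\<^sup>2) \<le> C * (\<Sum>s<n. (cmod (f s))\<^sup>2)"
  shows "trace_split n' Y (C * t)"
proof -
  obtain P N where P: "psd n P" and N: "psd n N" and PN: "X = P - N"
    and t: "Re (mat_trace P) + Re (mat_trace N) \<le> t"
    using X by (auto simp: trace_split_def)
  define K where "K = (\<lambda>M. mat n' n' (\<lambda>(r, c). \<Sum>s<n. \<Sum>t<n. V r s * M $$ (s, t) * cnj (V c t)))"
  have "psd n' (K P)" "psd n' (K N)"
    and tr: "Re (mat_trace (K P)) \<le> C * Re (mat_trace P)" "Re (mat_trace (K N)) \<le> C * Re (mat_trace N)"
    unfolding K_def using psd_conj[OF P C V] psd_conj[OF N C V] by auto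
  moreover have "Y = K P - K N"
  proof (rule eq_matI)
    fix r c assume "r < dim_row (K P - K N)" "c < dim_col (K P - K N)"
    then have rc: "r < n'" "c < n'" by (auto simp: K_def)
    have "Y $$ (r, c) = (\<Sum>s<n. \<Sum>t<n. V r s * P $$ (s, t) * cnj (V c t) - V r s * N $$ (s, t) * cnj (V c t))"
      unfolding YX[OF rc] using psd_carrier[OF P] psd_carrier[OF N]
      by (intro sum.cong refl) (simp add: PN algebra_simps)
    then show "Y $$ (r, c) = (K P - K N) $$ (r, c)"
      using rc by (simp add: K_def sum_subtractf)
  qed (use Y in \<open>auto simp: K_def\<close>)
  moreover have "Re (mat_trace (K P)) + Re (mat_trace (K N)) \<le> C * t"
  proof -
    have "C * Re (mat_trace P) + C * Re (mat_trace N) \<le> C * t"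
      using mult_left_mono[OF t C] by (simp add: algebra_simps)
    then show ?thesis using tr by linarith
  qed
  ultimately show ?thesis unfolding trace_split_def by blast
qed

text \<open>The triangle inequality: splittings are added part by part.\<close>

lemma trace_split_sum:
  assumes X: "\<And>q. q \<in> Q \<Longrightarrow> trace_split n (X q) (t q)" and Y: "Y \<in> carrier_mat n n"
    and YX: "\<And>r c. r < n \<Longrightarrow> c < n \<Longrightarrow> Y $$ (r, c) = (\<Sum>q\<in>Q. X q $$ (r, c))"
  shows "trace_split n Y (\<Sum>q\<in>Q. t q)"
proof -
  have "\<forall>q. \<exists>P N. q \<in> Q \<longrightarrow> psd n P \<and> psd n N \<and> X q = P - N \<and> Re (mat_trace P) + Re (mat_trace N) \<le> t q"
    using X by (auto simp: trace_split_def)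
  then obtain P N where PN: "\<And>q. q \<in> Q \<Longrightarrow> psd n (P q)" "\<And>q. q \<in> Q \<Longrightarrow> psd n (N q)"
    "\<And>q. q \<in> Q \<Longrightarrow> X q = P q - N q" "\<And>q. q \<in> Q \<Longrightarrow> Re (mat_trace (P q)) + Re (mat_trace (N q)) \<le> t q"
    by metis
  define S where "S = (\<lambda>M. mat n n (\<lambda>(r, c). \<Sum>q\<in>Q. M q $$ (r, c)) :: complex mat)"
  have S: "S M \<in> carrier_mat n n" for M :: "_ \<Rightarrow> complex mat" by (simp add: S_def)
  have Sp: "psd n (S M)" if M: "\<And>q. q \<in> Q \<Longrightarrow> psd n (M q)" for M
  proof -
    have "quad_form n (S M) f = (\<Sum>q\<in>Q. quad_form n (M q) f)" for f
    proof -
      have "quad_form n (S M) f = (\<Sum>r<n. \<Sum>c<n. \<Sum>q\<in>Q. cnj (f r) * M q $$ (r, c) * f c)"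
        by (simp add: quad_form_def S_def sum_distrib_left sum_distrib_right)
      also have "\<dots> = (\<Sum>q\<in>Q. \<Sum>r<n. \<Sum>c<n. cnj (f r) * M q $$ (r, c) * f c)"
        by (simp only: sum.swap[where B = Q])
      finally show ?thesis by (simp add: quad_form_def)
    qed
    moreover have "0 \<le> Re (quad_form n (M q) f)" "Im (quad_form n (M q) f) = 0" if "q \<in> Q" for q f
      using M[OF that] by (auto simp: psd_iff_quad_form less_eq_complex_def)
    ultimately show ?thesis using S
      by (auto simp: psd_iff_quad_form less_eq_complex_def intro!: sum_nonneg)
  qed
  have St: "mat_trace (S M) = (\<Sum>q\<in>Q. mat_trace (M q))" if M: "\<And>q. q \<in> Q \<Longrightarrow> psd n (M q)" for M
  proof -
    have "mat_trace (S M) = (\<Sum>r<n. \<Sum>q\<in>Q. M q $$ (r, r))" by (simp add: mat_trace_def S_def)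
    also have "\<dots> = (\<Sum>q\<in>Q. \<Sum>r<n. M q $$ (r, r))" by (rule sum.swap)
    also have "\<dots> = (\<Sum>q\<in>Q. mat_trace (M q))"
      using psd_carrier[OF M] by (intro sum.cong refl) (auto simp: mat_trace_def)
    finally show ?thesis .
  qed
  have "Y = S P - S N"
  proof (rule eq_matI)
    fix r c assume "r < dim_row (S P - S N)" "c < dim_col (S P - S N)"
    then have rc: "r < n" "c < n" by (auto simp: S_def)
    have "Y $$ (r, c) = (\<Sum>q\<in>Q. P q $$ (r, c) - N q $$ (r, c))"
      unfolding YX[OF rc]
    proof (intro sum.cong refl)
      fix q assume "q \<in> Q"
      then show "X q $$ (r, c) = P q $$ (r, c) - N q $$ (r, c)"
        using rc psd_carrier[OF PN(2)[of q]] by (simp add: PN(3))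
    qed
    then show "Y $$ (r, c) = (S P - S N) $$ (r, c)" using rc by (simp add: S_def sum_subtractf)
  qed (use Y in \<open>auto simp: S_def\<close>)
  moreover have "Re (mat_trace (S P)) + Re (mat_trace (S N)) \<le> (\<Sum>q\<in>Q. t q)"
  proof -
    have "mat_trace (S P) = (\<Sum>q\<in>Q. mat_trace (P q))" "mat_trace (S N) = (\<Sum>q\<in>Q. mat_trace (N q))"
      by (intro St PN(1,2); assumption)+
    then show ?thesis unfolding Re_sum by (simp only: Re_sum sum.distrib[symmetric]) (intro sum_mono PN(4))
  qed
  moreover have "psd n (S P)" "psd n (S N)" by (intro Sp PN(1,2); assumption)+
  ultimately show ?thesis unfolding trace_split_def by blast
qed

section \<open>Linear maps acting on one tensor factor\<close>

lemma linear_map_sum: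
  assumes L: "linear_map m m' \<Lambda>" and "finite Q" and "\<And>q. q \<in> Q \<Longrightarrow> E q \<in> carrier_mat m m"
    and xy: "x < m'" "y < m'"
  shows "\<Lambda> (mat m m (\<lambda>(a, b). \<Sum>q\<in>Q. z q * E q $$ (a, b))) $$ (x, y) = (\<Sum>q\<in>Q. z q * \<Lambda> (E q) $$ (x, y))"
  using assms(2,3)
proof (induction Q rule: finite_induct)
  case empty
  \<comment> \<open>Writing the zero matrix as 0 times itself lets homogeneity show that its image
    vanishes.\<close>
  have zero: "mat m m (\<lambda>(a, b). \<Sum>q\<in>{}. z q * E q $$ (a, b)) = 0 \<cdot>\<^sub>m 0\<^sub>m m m" by (rule eq_matI) auto
  have lin: "\<Lambda> (0 \<cdot>\<^sub>m 0\<^sub>m m m) = 0 \<cdot>\<^sub>m \<Lambda> (0\<^sub>m m m)" and c: "\<Lambda> (0\<^sub>m m m) \<in> carrier_mat m' m'"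
    using L zero_carrier_mat[of m m] unfolding linear_map_def by blast+
  show ?case unfolding zero lin using c xy by simp
next
  case (insert q Q)
  let ?R = "mat m m (\<lambda>(a, b). \<Sum>q\<in>Q. z q * E q $$ (a, b))"
  have E: "E q \<in> carrier_mat m m" using insert by auto
  have add: "mat m m (\<lambda>(a, b). \<Sum>q\<in>insert q Q. z q * E q $$ (a, b)) = z q \<cdot>\<^sub>m E q + ?R"
    using insert.hyps E by (intro eq_matI) auto
  have lin: "\<Lambda> (z q \<cdot>\<^sub>m E q + ?R) = z q \<cdot>\<^sub>m \<Lambda> (E q) + \<Lambda> ?R"
    and c: "\<Lambda> (E q) \<in> carrier_mat m' m'" "\<Lambda> ?R \<in> carrier_mat m' m'"
    using L E by (auto simp: linear_map_def)
  have IH: "\<Lambda> ?R $$ (x, y) = (\<Sum>q\<in>Q. z q * \<Lambda> (E q) $$ (x, y))"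
    using insert.IH insert.prems by blast
  have "(z q \<cdot>\<^sub>m \<Lambda> (E q) + \<Lambda> ?R) $$ (x, y) = z q * \<Lambda> (E q) $$ (x, y) + \<Lambda> ?R $$ (x, y)"
    using c xy by simp
  then show ?case unfolding add lin IH using insert.hyps by simp
qed

definition matrix_unit :: "nat \<Rightarrow> nat \<Rightarrow> nat \<Rightarrow> complex mat" where
  "matrix_unit m i j = mat m m (\<lambda>(a, b). if a = i \<and> b = j then 1 else 0)"

text \<open>Expansion in matrix units turns a map into an array of numbers, so that two channels
  enter the estimates only through the differences of these numbers.\<close>

lemma linear_map_entry:
  assumes L: "linear_map m m' \<Lambda>" and X: "X \<in> carrier_mat m m" and xy: "x < m'" "y < m'"
  shows "\<Lambda> X $$ (x, y) = (\<Sum>i<m. \<Sum>j<m. X $$ (i, j) * \<Lambda> (matrix_unit m i j) $$ (x, y))"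
proof -
  define Q where "Q = {..<m} \<times> {..<m}"
  define E where "E = (\<lambda>(i, j). matrix_unit m i j)"
  have "X = mat m m (\<lambda>(a, b). \<Sum>q\<in>Q. X $$ q * E q $$ (a, b))"
  proof (rule eq_matI)
    fix a b assume "a < dim_row (mat m m (\<lambda>(a, b). \<Sum>q\<in>Q. X $$ q * E q $$ (a, b)))"
      "b < dim_col (mat m m (\<lambda>(a, b). \<Sum>q\<in>Q. X $$ q * E q $$ (a, b)))"
    then have ab: "a < m" "b < m" by auto
    have "(\<Sum>q\<in>Q. X $$ q * E q $$ (a, b)) = (\<Sum>q\<in>Q. if q = (a, b) then X $$ (a, b) else 0)"
      using ab by (intro sum.cong) (auto simp: E_def matrix_unit_def split: if_splits)
    also have "\<dots> = X $$ (a, b)" using ab by (simp add: Q_def)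
    finally show "X $$ (a, b) = mat m m (\<lambda>(a, b). \<Sum>q\<in>Q. X $$ q * E q $$ (a, b)) $$ (a, b)"
      using ab by simp
  qed (use X in auto)
  moreover have "\<Lambda> (mat m m (\<lambda>(a, b). \<Sum>q\<in>Q. X $$ q * E q $$ (a, b))) $$ (x, y)
      = (\<Sum>q\<in>Q. X $$ q * \<Lambda> (E q) $$ (x, y))"
    using xy by (intro linear_map_sum[OF L]) (auto simp: Q_def E_def matrix_unit_def)
  moreover have "\<dots> = (\<Sum>i<m. \<Sum>j<m. X $$ (i, j) * \<Lambda> (matrix_unit m i j) $$ (x, y))"
    unfolding sum.cartesian_product Q_def by (intro sum.cong) (auto simp: E_def)
  ultimately show ?thesis by simp
qed

lemma apply_fst_carrier [simp]: "apply_fst m m' n \<Lambda> M \<in> carrier_mat (m' * n) (m' * n)"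
  by (simp add: apply_fst_def)

lemma apply_fst_index:
  assumes "x < m'" "y < m'" "k < n" "l < n"
  shows "apply_fst m m' n \<Lambda> M $$ (x * n + k, y * n + l)
       = \<Lambda> (mat m m (\<lambda>(i, j). M $$ (i * n + k, j * n + l))) $$ (x, y)"
  using assms prod_index_less[of x m' k n] prod_index_less[of y m' l n] by (simp add: apply_fst_def)

lemma apply_fst_entry:
  assumes L: "linear_map m m' \<Lambda>" and "x < m'" "y < m'" "k < n" "l < n"
  shows "apply_fst m m' n \<Lambda> M $$ (x * n + k, y * n + l)
       = (\<Sum>i<m. \<Sum>j<m. M $$ (i * n + k, j * n + l) * \<Lambda> (matrix_unit m i j) $$ (x, y))"
  using assms by (simp add: apply_fst_index linear_map_entry[OF L])

text \<open>The indices k and l of the untouched factor occur only in M, the map only in the other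
  factor of each term. This separation is the reason why operators on the second factor commute with
  the map.\<close>

lemma apply_fst_diff_entry:
  assumes L: "linear_map m m' \<Lambda>\<^sub>0" "linear_map m m' \<Lambda>\<^sub>1" and "x < m'" "y < m'" "k < n" "l < n"
  shows "(apply_fst m m' n \<Lambda>\<^sub>0 M - apply_fst m m' n \<Lambda>\<^sub>1 M) $$ (x * n + k, y * n + l)
       = (\<Sum>i<m. \<Sum>j<m. M $$ (i * n + k, j * n + l)
           * (\<Lambda>\<^sub>0 (matrix_unit m i j) $$ (x, y) - \<Lambda>\<^sub>1 (matrix_unit m i j) $$ (x, y)))"
  using assms(3-) prod_index_less[of x m' k n] prod_index_less[of y m' l n]
    carrier_matD[OF apply_fst_carrier[of m m' n \<Lambda>\<^sub>1 M]]
  by (simp add: apply_fst_entry[OF L(1)] apply_fst_entry[OF L(2)] right_diff_distrib sum_subtractf)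

section \<open>Filtering by an operator on the untouched factor\<close>

lemma cmod_sum_mult_le:
  "(cmod (\<Sum>s\<in>A. a s * b s))\<^sup>2 \<le> (\<Sum>s\<in>A. (cmod (a s))\<^sup>2) * (\<Sum>s\<in>A. (cmod (b s))\<^sup>2)"
proof -
  have "cmod (\<Sum>s\<in>A. a s * b s) \<le> (\<Sum>s\<in>A. \<bar>cmod (a s)\<bar> * \<bar>cmod (b s)\<bar>)"
    by (rule order_trans[OF norm_sum]) (simp add: norm_mult)
  also have "\<dots> \<le> L2_set (\<lambda>s. cmod (a s)) A * L2_set (\<lambda>s. cmod (b s)) A"
    by (rule L2_set_mult_ineq)
  finally have "(cmod (\<Sum>s\<in>A. a s * b s))\<^sup>2 \<le> (L2_set (\<lambda>s. cmod (a s)) A * L2_set (\<lambda>s. cmod (b s)) A)\<^sup>2"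
    by (intro power_mono) auto
  also have "\<dots> = (\<Sum>s\<in>A. (cmod (a s))\<^sup>2) * (\<Sum>s\<in>A. (cmod (b s))\<^sup>2)"
    by (simp add: power_mult_distrib L2_set_def sum_nonneg)
  finally show ?thesis .
qed

lemma parseval:
  fixes m n :: nat
  assumes \<beta>: "\<And>q q'. q < m \<Longrightarrow> q' < m \<Longrightarrow> (\<Sum>k<n. \<beta> q k * cnj (\<beta> q' k)) = (if q = q' then 1 else 0)"
  shows "(\<Sum>k<n. (cmod (\<Sum>q<m. c q * \<beta> q k))\<^sup>2) = (\<Sum>q<m. (cmod (c q))\<^sup>2)"
proof -
  have "complex_of_real (\<Sum>k<n. (cmod (\<Sum>q<m. c q * \<beta> q k))\<^sup>2)
      = (\<Sum>k<n. (\<Sum>q<m. c q * \<beta> q k) * cnj (\<Sum>q<m. c q * \<beta> q k))"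
    unfolding of_real_sum mult_cnj_norm ..
  also have "\<dots> = (\<Sum>k<n. \<Sum>q<m. \<Sum>q'<m. c q * cnj (c q') * (\<beta> q k * cnj (\<beta> q' k)))"
    by (simp add: sum_product mult_ac)
  also have "\<dots> = (\<Sum>q<m. \<Sum>k<n. \<Sum>q'<m. c q * cnj (c q') * (\<beta> q k * cnj (\<beta> q' k)))"
    by (rule sum.swap)
  also have "\<dots> = (\<Sum>q<m. \<Sum>q'<m. \<Sum>k<n. c q * cnj (c q') * (\<beta> q k * cnj (\<beta> q' k)))"
    by (intro sum.cong[OF refl] sum.swap)
  also have "\<dots> = (\<Sum>q<m. \<Sum>q'<m. if q' = q then c q * cnj (c q) else 0)"
    by (intro sum.cong refl) (simp add: \<beta> flip: sum_distrib_left)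
  also have "\<dots> = complex_of_real (\<Sum>q<m. (cmod (c q))\<^sup>2)"
    unfolding of_real_sum mult_cnj_norm[symmetric] by (intro sum.cong refl) simp
  finally show ?thesis by (simp only: of_real_eq_iff)
qed

text \<open>Filtering: a vector \<open>\<psi>\<close> with full Schmidt rank on the first factor is carried to an
  arbitrary \<open>\<phi>\<close> by an operator \<open>1 \<otimes> K\<close>, which commutes with maps acting on the first factor;
  the Hilbert-Schmidt norm of \<open>K\<close> is at most \<open>\<parallel>\<phi>\<parallel>\<close> over the least Schmidt coefficient.\<close>

lemma schmidt_filter:
  fixes \<psi> \<phi> :: "nat \<Rightarrow> complex" and s :: "nat \<Rightarrow> real"
  assumes X: "trace_split (m' * n) X t"
    and Xe: "\<And>x y k l. x < m' \<Longrightarrow> y < m' \<Longrightarrow> k < n \<Longrightarrow> l < n \<Longrightarrow>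
      X $$ (x * n + k, y * n + l) = (\<Sum>i<m. \<Sum>j<m. \<psi> (i * n + k) * cnj (\<psi> (j * n + l)) * D i j x y)"
    and Y: "Y \<in> carrier_mat (m' * n') (m' * n')"
    and Ye: "\<And>x y k l. x < m' \<Longrightarrow> y < m' \<Longrightarrow> k < n' \<Longrightarrow> l < n' \<Longrightarrow>
      Y $$ (x * n' + k, y * n' + l) = (\<Sum>i<m. \<Sum>j<m. \<phi> (i * n' + k) * cnj (\<phi> (j * n' + l)) * D i j x y)"
    and \<psi>: "\<And>i k. i < m \<Longrightarrow> k < n \<Longrightarrow> \<psi> (i * n + k) = (\<Sum>q<m. complex_of_real (s q) * \<alpha> q i * \<beta> q k)"
    and \<alpha>: "orthonormal_basis m \<alpha>"
    and \<beta>: "\<And>q q'. q < m \<Longrightarrow> q' < m \<Longrightarrow> (\<Sum>k<n. \<beta> q k * cnj (\<beta> q' k)) = (if q = q' then 1 else 0)"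
    and p: "0 < p" "\<And>q. q < m \<Longrightarrow> p \<le> (s q)\<^sup>2"
  shows "trace_split (m' * n') Y ((\<Sum>r<m * n'. (cmod (\<phi> r))\<^sup>2) / p * t)"
proof -
  \<comment> \<open>The component of \<phi> along \<alpha>_q, so that \<phi> is the sum of the
    \<alpha>_q (x) g_q.\<close>
  define g where "g = (\<lambda>q k. \<Sum>i<m. \<phi> (i * n' + k) * cnj (\<alpha> q i))"
  \<comment> \<open>K sends \<open>s q\<close> times \<beta>_q to g_q and kills the complement of
    the \<beta>_q; hence 1 (x) K maps \<psi>, the sum of the \<open>s q\<close> \<alpha>_q (x)
    \<beta>_q, to \<phi>.\<close>
  define K where "K = (\<lambda>k r. \<Sum>q<m. g q k / s q * cnj (\<beta> q r))"
  define C where "C = (\<Sum>r<m * n'. (cmod (\<phi> r))\<^sup>2) / p"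
  \<comment> \<open>The matrix of 1 (x) K on the output space: the identity on the factor of
    dimension m', K from dimension n to n'.\<close>
  define V where "V = (\<lambda>r c. if r div n' = c div n then K (r mod n') (c mod n) else 0)"
  have C0: "0 \<le> C" using p by (simp add: C_def sum_nonneg)
  have s: "s q \<noteq> 0" if "q < m" for q using p(1) p(2)[OF that] by auto

  have \<beta>\<psi>: "(\<Sum>r<n. cnj (\<beta> q r) * \<psi> (i * n + r)) = s q * \<alpha> q i" if "q < m" "i < m" for q i
  proof -
    have "(\<Sum>r<n. cnj (\<beta> q r) * \<psi> (i * n + r))
        = (\<Sum>r<n. \<Sum>q'<m. s q' * \<alpha> q' i * (\<beta> q' r * cnj (\<beta> q r)))"
      using that by (intro sum.cong refl) (simp add: \<psi> sum_distrib_left mult_ac)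
    also have "\<dots> = (\<Sum>q'<m. s q' * \<alpha> q' i * (\<Sum>r<n. \<beta> q' r * cnj (\<beta> q r)))"
      by (subst sum.swap) (simp add: sum_distrib_left)
    also have "\<dots> = (\<Sum>q'<m. if q' = q then s q * \<alpha> q i else 0)"
      using that by (intro sum.cong refl) (simp add: \<beta>)
    finally show ?thesis using that by simp
  qed
  have K\<psi>: "(\<Sum>r<n. K k r * \<psi> (i * n + r)) = \<phi> (i * n' + k)" if "i < m" "k < n'" for i k
  proof -
    have "(\<Sum>r<n. K k r * \<psi> (i * n + r))
        = (\<Sum>r<n. \<Sum>q<m. g q k / s q * (cnj (\<beta> q r) * \<psi> (i * n + r)))"
      unfolding K_def sum_distrib_right by (intro sum.cong refl) (simp only: mult.assoc)
    also have "\<dots> = (\<Sum>q<m. g q k / s q * (\<Sum>r<n. cnj (\<beta> q r) * \<psi> (i * n + r)))"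
      by (subst sum.swap) (simp add: sum_distrib_left)
    also have "\<dots> = (\<Sum>q<m. g q k * \<alpha> q i)"
      using that s by (intro sum.cong refl) (simp add: \<beta>\<psi>)
    also have "\<dots> = (\<Sum>q<m. \<Sum>i'<m. \<phi> (i' * n' + k) * (\<alpha> q i * cnj (\<alpha> q i')))"
      by (simp add: g_def sum_distrib_right sum_distrib_left mult_ac)
    also have "\<dots> = (\<Sum>i'<m. \<phi> (i' * n' + k) * (\<Sum>q<m. \<alpha> q i * cnj (\<alpha> q i')))"
      by (subst sum.swap) (simp add: sum_distrib_left)
    also have "\<dots> = (\<Sum>i'<m. if i' = i then \<phi> (i * n' + k) else 0)"
      using \<alpha> that by (intro sum.cong refl) (auto simp: orthonormal_basis_def)
    finally show ?thesis using that by simp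
  qed
  \<comment> \<open>The squared Hilbert-Schmidt norm of K is the sum of |g_q|^2 / (s q)^2, and the
    |g_q|^2 add up to |\<phi>|^2.\<close>
  have HS: "(\<Sum>k<n'. \<Sum>r<n. (cmod (K k r))\<^sup>2) \<le> C"
  proof -
    have "(\<Sum>k<n'. \<Sum>r<n. (cmod (K k r))\<^sup>2) = (\<Sum>k<n'. \<Sum>q<m. (cmod (g q k / s q))\<^sup>2)"
    proof (rule sum.cong[OF refl])
      fix k
      show "(\<Sum>r<n. (cmod (K k r))\<^sup>2) = (\<Sum>q<m. (cmod (g q k / s q))\<^sup>2)"
        unfolding K_def
      proof (rule parseval)
        fix q q' assume "q < m" "q' < m"
        then show "(\<Sum>k<n. cnj (\<beta> q k) * cnj (cnj (\<beta> q' k))) = (if q = q' then 1 else 0)"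
          using \<beta>[of q' q] by (auto simp: mult.commute)
      qed
    qed
    also have "\<dots> \<le> (\<Sum>k<n'. \<Sum>q<m. (cmod (g q k))\<^sup>2 / p)"
      using p by (intro sum_mono) (simp add: norm_divide power_divide divide_left_mono frac_le)
    also have "\<dots> = (\<Sum>k<n'. \<Sum>i<m. (cmod (\<phi> (i * n' + k)))\<^sup>2) / p"
    proof -
      \<comment> \<open>Here \<open>parseval\<close> is used in the index q; the orthonormality it
        asks for is the completeness relation of \<alpha>.\<close>
      have "(\<Sum>q<m. (cmod (g q k))\<^sup>2) = (\<Sum>i<m. (cmod (\<phi> (i * n' + k)))\<^sup>2)" for k
        unfolding g_def
      proof (rule parseval)
        fix i i' assume "i < m" "i' < m"
        then show "(\<Sum>q<m. cnj (\<alpha> q i) * cnj (cnj (\<alpha> q i'))) = (if i = i' then 1 else 0)"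
          using \<alpha> by (auto simp: orthonormal_basis_def mult.commute)
      qed
      then show ?thesis by (simp add: sum_divide_distrib[symmetric])
    qed
    also have "\<dots> = C"
      unfolding C_def sum_prod_index by (subst sum.swap) simp
    finally show ?thesis .
  qed

  have V: "V (x * n' + k) (x' * n + a) = (if x = x' then K k a else 0)" if "k < n'" "a < n" for x k x' a
    using that by (simp add: V_def)
  have Vsum: "(\<Sum>c<m' * n. V (x * n' + k) c * f c) = (\<Sum>a<n. K k a * f (x * n + a))"
    if "k < n'" "x < m'" for x k and f :: "nat \<Rightarrow> complex"
  proof -
    have "(\<Sum>c<m' * n. V (x * n' + k) c * f c) = (\<Sum>x'<m'. if x' = x then (\<Sum>a<n. K k a * f (x * n + a)) else 0)"
      unfolding sum_prod_index using that by (intro sum.cong refl) (auto simp: V)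
    then show ?thesis using that by simp
  qed
  show ?thesis
    unfolding C_def[symmetric]
  proof (rule trace_split_conj[OF X Y C0])
    fix r c assume r: "r < m' * n'" and c: "c < m' * n'"
    obtain x k where rx: "r = x * n' + k" "x < m'" "k < n'" using r by (rule prod_index_cases)
    obtain y l where cy: "c = y * n' + l" "y < m'" "l < n'" using c by (rule prod_index_cases)
    \<comment> \<open>The inner sum is put under a conjugation so that \<open>Vsum\<close>, which
      evaluates a row of V, applies to both sides of X.\<close>
    have "(\<Sum>u<m' * n. \<Sum>v<m' * n. V r u * X $$ (u, v) * cnj (V c v))
        = (\<Sum>u<m' * n. V r u * cnj (\<Sum>v<m' * n. V c v * cnj (X $$ (u, v))))"
      by (simp add: sum_distrib_left mult_ac)
    also have "\<dots> = (\<Sum>a<n. K k a * cnj (\<Sum>b<n. K l b * cnj (X $$ (x * n + a, y * n + b))))"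
      unfolding rx(1) cy(1) Vsum[OF rx(3,2)] Vsum[OF cy(3,2)] ..
    also have "\<dots> = (\<Sum>a<n. \<Sum>b<n. K k a * cnj (K l b) * X $$ (x * n + a, y * n + b))"
      by (simp add: sum_distrib_left mult_ac)
    also have "\<dots> = (\<Sum>a<n. \<Sum>b<n. \<Sum>i<m. \<Sum>j<m.
        (K k a * \<psi> (i * n + a)) * cnj (K l b * \<psi> (j * n + b)) * D i j x y)"
    proof (intro sum.cong refl)
      fix a b assume "a \<in> {..<n}" "b \<in> {..<n}"
      then have "X $$ (x * n + a, y * n + b)
          = (\<Sum>i<m. \<Sum>j<m. \<psi> (i * n + a) * cnj (\<psi> (j * n + b)) * D i j x y)"
        using rx cy by (intro Xe) auto
      then show "K k a * cnj (K l b) * X $$ (x * n + a, y * n + b)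
          = (\<Sum>i<m. \<Sum>j<m. (K k a * \<psi> (i * n + a)) * cnj (K l b * \<psi> (j * n + b)) * D i j x y)"
        by (simp add: sum_distrib_left mult_ac)
    qed
    \<comment> \<open>With the input indices outermost, K meets nothing but \<psi>, and
      \<open>K\<psi>\<close> turns it into \<phi>.\<close>
    also have "\<dots> = (\<Sum>i<m. \<Sum>j<m. \<Sum>a<n. \<Sum>b<n.
        (K k a * \<psi> (i * n + a)) * cnj (K l b * \<psi> (j * n + b)) * D i j x y)"
    proof -
      have swap3: "(\<Sum>a<n. \<Sum>b<n. \<Sum>i<m. F a b i) = (\<Sum>i<m. \<Sum>a<n. \<Sum>b<n. F a b i)"
        for F :: "nat \<Rightarrow> nat \<Rightarrow> nat \<Rightarrow> complex"
      proof -
        have "(\<Sum>a<n. \<Sum>b<n. \<Sum>i<m. F a b i) = (\<Sum>a<n. \<Sum>i<m. \<Sum>b<n. F a b i)"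
          by (intro sum.cong[OF refl] sum.swap)
        also have "\<dots> = (\<Sum>i<m. \<Sum>a<n. \<Sum>b<n. F a b i)" by (rule sum.swap)
        finally show ?thesis .
      qed
      show ?thesis by (subst swap3, intro sum.cong[OF refl] swap3)
    qed
    also have "\<dots> = (\<Sum>i<m. \<Sum>j<m. (\<Sum>a<n. K k a * \<psi> (i * n + a)) * cnj (\<Sum>b<n. K l b * \<psi> (j * n + b)) * D i j x y)"
      by (intro sum.cong refl) (subst cnj_sum, subst sum_product, simp only: sum_distrib_right)
    also have "\<dots> = Y $$ (r, c)"
      using rx cy by (simp add: K\<psi> Ye)
    finally show "Y $$ (r, c) = (\<Sum>u<m' * n. \<Sum>v<m' * n. V r u * X $$ (u, v) * cnj (V c v))" ..
  next
    \<comment> \<open>Cauchy-Schwarz in each block x: the Hilbert-Schmidt norm of K dominates the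
      operator norm of 1 (x) K.\<close>
    fix f :: "nat \<Rightarrow> complex"
    have "(\<Sum>r<m' * n'. (cmod (\<Sum>c<m' * n. V r c * f c))\<^sup>2)
        = (\<Sum>x<m'. \<Sum>k<n'. (cmod (\<Sum>a<n. K k a * f (x * n + a)))\<^sup>2)"
      unfolding sum_prod_index[of _ m' n'] by (intro sum.cong refl) (simp add: Vsum)
    also have "\<dots> \<le> (\<Sum>x<m'. \<Sum>k<n'. (\<Sum>a<n. (cmod (K k a))\<^sup>2) * (\<Sum>a<n. (cmod (f (x * n + a)))\<^sup>2))"
      by (intro sum_mono cmod_sum_mult_le)
    also have "\<dots> = (\<Sum>k<n'. \<Sum>a<n. (cmod (K k a))\<^sup>2) * (\<Sum>x<m'. \<Sum>a<n. (cmod (f (x * n + a)))\<^sup>2)"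
      by (simp only: sum_distrib_left[symmetric] sum_distrib_right[symmetric])
    also have "\<dots> \<le> C * (\<Sum>x<m'. \<Sum>a<n. (cmod (f (x * n + a)))\<^sup>2)"
      using HS by (intro mult_right_mono sum_nonneg) auto
    finally show "(\<Sum>r<m' * n'. (cmod (\<Sum>c<m' * n. V r c * f c))\<^sup>2) \<le> C * (\<Sum>c<m' * n. (cmod (f c))\<^sup>2)"
      by (simp add: sum_prod_index)
  qed
qed

lemma psd_apply_fst:
  "channel m m' \<Lambda> \<Longrightarrow> psd (m * n) M \<Longrightarrow> psd (m' * n) (apply_fst m m' n \<Lambda> M)"
  by (simp add: channel_def completely_positive_def)

lemma ket_bra_index [simp]:
  "r < dim_vec \<psi> \<Longrightarrow> c < dim_vec \<psi> \<Longrightarrow> ket_bra \<psi> $$ (r, c) = \<psi> $ r * cnj (\<psi> $ c)"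
  by (simp add: ket_bra_def)

lemma psd_ket_bra: "\<psi> \<in> carrier_vec n \<Longrightarrow> psd n (ket_bra \<psi>)"
  by (rule psd_gramI[where J = "{()}" and w = "\<lambda>_. ($) \<psi>"]) (auto simp: ket_bra_def)

lemma trace_ket_bra: "mat_trace (ket_bra \<psi>) = complex_of_real (\<Sum>r<dim_vec \<psi>. (cmod (\<psi> $ r))\<^sup>2)"
  by (simp add: mat_trace_def ket_bra_def mult_cnj_norm)

lemma apply_fst_diff_split:
  assumes ch: "channel m m' \<Lambda>\<^sub>0" "channel m m' \<Lambda>\<^sub>1" and M: "psd (m * n) M"
  shows "trace_split (m' * n) (apply_fst m m' n \<Lambda>\<^sub>0 M - apply_fst m m' n \<Lambda>\<^sub>1 M)
    (2 * trace_dist (apply_fst m m' n \<Lambda>\<^sub>0 M) (apply_fst m m' n \<Lambda>\<^sub>1 M))"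
  and "0 \<le> trace_dist (apply_fst m m' n \<Lambda>\<^sub>0 M) (apply_fst m m' n \<Lambda>\<^sub>1 M)"
  using trace_split_trace_norm[OF psd_apply_fst[OF ch(1) M] psd_apply_fst[OF ch(2) M]]
    trace_norm_nonneg[OF psd_apply_fst[OF ch(1) M] psd_apply_fst[OF ch(2) M]]
  by (auto simp: trace_dist_def)

text \<open>The mixed input is a sum of w_q w_q^dagger with unnormalized w_q, so the filter factors
  |w_q|^2 / p add up to tr \<rho> / p = 1 / p. The ancilla dimension n' is independent of n, which
  allows B to be compared with the copy of A in the diamond distance.\<close>

lemma trace_dist_le_schmidt:
  fixes s :: "nat \<Rightarrow> real"
  assumes ch: "channel m m' \<Lambda>\<^sub>0" "channel m m' \<Lambda>\<^sub>1" and \<psi>c: "\<psi> \<in> carrier_vec (m * n)"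
    and \<psi>: "\<And>i k. i < m \<Longrightarrow> k < n \<Longrightarrow> \<psi> $ (i * n + k) = (\<Sum>q<m. complex_of_real (s q) * \<alpha> q i * \<beta> q k)"
    and \<alpha>: "orthonormal_basis m \<alpha>"
    and \<beta>: "\<And>q q'. q < m \<Longrightarrow> q' < m \<Longrightarrow> (\<Sum>k<n. \<beta> q k * cnj (\<beta> q' k)) = (if q = q' then 1 else 0)"
    and p: "0 < p" "\<And>q. q < m \<Longrightarrow> p \<le> (s q)\<^sup>2"
    and \<rho>: "density_operator (m * n') \<rho>"
  shows "trace_dist (apply_fst m m' n' \<Lambda>\<^sub>0 \<rho>) (apply_fst m m' n' \<Lambda>\<^sub>1 \<rho>)
    \<le> trace_dist (apply_fst m m' n \<Lambda>\<^sub>0 (ket_bra \<psi>)) (apply_fst m m' n \<Lambda>\<^sub>1 (ket_bra \<psi>)) / p"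
proof -
  define D where "D = (\<lambda>i j x y. \<Lambda>\<^sub>0 (matrix_unit m i j) $$ (x, y) - \<Lambda>\<^sub>1 (matrix_unit m i j) $$ (x, y))"
  define t where "t = 2 * trace_dist (apply_fst m m' n \<Lambda>\<^sub>0 (ket_bra \<psi>)) (apply_fst m m' n \<Lambda>\<^sub>1 (ket_bra \<psi>))"
  define X where "X = apply_fst m m' n \<Lambda>\<^sub>0 (ket_bra \<psi>) - apply_fst m m' n \<Lambda>\<^sub>1 (ket_bra \<psi>)"
  define Y where "Y = apply_fst m m' n' \<Lambda>\<^sub>0 \<rho> - apply_fst m m' n' \<Lambda>\<^sub>1 \<rho>"
  have L: "linear_map m m' \<Lambda>\<^sub>0" "linear_map m m' \<Lambda>\<^sub>1" using ch by (auto simp: channel_def)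
  have X: "trace_split (m' * n) X t"
    unfolding X_def t_def by (rule apply_fst_diff_split(1)[OF ch psd_ket_bra[OF \<psi>c]])
  have Xe: "X $$ (x * n + k, y * n + l) = (\<Sum>i<m. \<Sum>j<m. \<psi> $ (i * n + k) * cnj (\<psi> $ (j * n + l)) * D i j x y)"
    if "x < m'" "y < m'" "k < n" "l < n" for x y k l
    unfolding X_def apply_fst_diff_entry[OF L that] D_def
    using \<psi>c that by (intro sum.cong refl) (simp add: prod_index_less)
  have \<rho>p: "psd (m * n') \<rho>" and \<rho>t: "mat_trace \<rho> = 1" using \<rho> by (auto simp: density_operator_def)
  obtain w where w: "\<And>r c. r < m * n' \<Longrightarrow> c < m * n' \<Longrightarrow> \<rho> $$ (r, c) = (\<Sum>q<m * n'. w q r * cnj (w q c))"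
    using psd_gramE[OF \<rho>p] by blast
  \<comment> \<open>The output difference for the pure input w_q, spelled out through the
    coefficients \<open>D\<close>.\<close>
  define Z where "Z = (\<lambda>q. mat (m' * n') (m' * n') (\<lambda>(r, c). \<Sum>i<m. \<Sum>j<m.
      w q (i * n' + r mod n') * cnj (w q (j * n' + c mod n')) * D i j (r div n') (c div n')))"
  have "trace_split (m' * n') (Z q) ((\<Sum>r<m * n'. (cmod (w q r))\<^sup>2) / p * t)" for q
  proof (rule schmidt_filter[OF X Xe _ _ \<psi> \<alpha> \<beta> p])
    show "Z q \<in> carrier_mat (m' * n') (m' * n')" by (simp add: Z_def)
    fix x y k l assume "x < m'" "y < m'" "k < n'" "l < n'"
    then show "Z q $$ (x * n' + k, y * n' + l)
        = (\<Sum>i<m. \<Sum>j<m. w q (i * n' + k) * cnj (w q (j * n' + l)) * D i j x y)"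
      by (simp add: Z_def prod_index_less)
  qed
  then have "trace_split (m' * n') Y (\<Sum>q<m * n'. (\<Sum>r<m * n'. (cmod (w q r))\<^sup>2) / p * t)"
  proof (rule trace_split_sum)
    show "Y \<in> carrier_mat (m' * n') (m' * n')"
      unfolding Y_def by (rule minus_carrier_mat) simp
    fix r c assume r: "r < m' * n'" and c: "c < m' * n'"
    obtain x k where rx: "r = x * n' + k" "x < m'" "k < n'" using r by (rule prod_index_cases)
    obtain y l where cy: "c = y * n' + l" "y < m'" "l < n'" using c by (rule prod_index_cases)
    have "Y $$ (r, c) = (\<Sum>i<m. \<Sum>j<m. \<Sum>q<m * n'. w q (i * n' + k) * cnj (w q (j * n' + l)) * D i j x y)"
      unfolding Y_def rx(1) cy(1) apply_fst_diff_entry[OF L rx(2) cy(2) rx(3) cy(3)] D_def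
      using rx cy by (intro sum.cong refl) (simp add: w prod_index_less sum_distrib_right)
    also have "\<dots> = (\<Sum>i<m. \<Sum>q<m * n'. \<Sum>j<m. w q (i * n' + k) * cnj (w q (j * n' + l)) * D i j x y)"
      by (intro sum.cong[OF refl] sum.swap)
    also have "\<dots> = (\<Sum>q<m * n'. \<Sum>i<m. \<Sum>j<m. w q (i * n' + k) * cnj (w q (j * n' + l)) * D i j x y)"
      by (rule sum.swap)
    also have "\<dots> = (\<Sum>q<m * n'. Z q $$ (r, c))"
      using rx cy by (simp add: Z_def prod_index_less)
    finally show "Y $$ (r, c) = (\<Sum>q<m * n'. Z q $$ (r, c))" .
  qed
  moreover have "(\<Sum>q<m * n'. (\<Sum>r<m * n'. (cmod (w q r))\<^sup>2) / p * t) = t / p"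
  proof -
    have "mat_trace \<rho> = (\<Sum>q<m * n'. 1 * complex_of_real (\<Sum>r<m * n'. (cmod (w q r))\<^sup>2))"
      by (rule trace_rank_one_sum[OF psd_carrier[OF \<rho>p]]) (simp add: w)
    then have "(\<Sum>q<m * n'. \<Sum>r<m * n'. (cmod (w q r))\<^sup>2) = 1"
      using \<rho>t by (simp flip: of_real_sum of_real_power)
    then show ?thesis by (simp flip: sum_distrib_right sum_divide_distrib)
  qed
  ultimately have "trace_norm Y \<le> t / p" using trace_norm_le by metis
  then show ?thesis by (simp add: trace_dist_def Y_def t_def)
qed

text \<open>Definiteness of the trace norm: two nonnegative traces with nonpositive sum vanish, and
  with them all Gram vectors of P and N.\<close>

lemma trace_split_nonpos:
  assumes "trace_split n X t" "t \<le> 0" "r < n" "c < n"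
  shows "X $$ (r, c) = 0"
proof -
  obtain P N where P: "psd n P" and N: "psd n N" and X: "X = P - N"
    and t: "Re (mat_trace P) + Re (mat_trace N) \<le> t"
    using assms(1) by (auto simp: trace_split_def)
  have tr: "0 \<le> Re (mat_trace M) \<and> (Re (mat_trace M) \<le> 0 \<longrightarrow> M $$ (r, c) = 0)" if M: "psd n M" for M
  proof -
    obtain w where w: "\<And>r c. r < n \<Longrightarrow> c < n \<Longrightarrow> M $$ (r, c) = (\<Sum>q<n. w q r * cnj (w q c))"
      using psd_gramE[OF M] by blast
    have "mat_trace M = (\<Sum>q<n. 1 * complex_of_real (\<Sum>r<n. (cmod (w q r))\<^sup>2))"
      by (rule trace_rank_one_sum[OF psd_carrier[OF M]]) (simp add: w)
    then have tr: "Re (mat_trace M) = (\<Sum>q<n. \<Sum>r<n. (cmod (w q r))\<^sup>2)" by simp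
    have "M $$ (r, c) = 0" if "Re (mat_trace M) \<le> 0"
    proof -
      have "(\<Sum>q<n. \<Sum>r<n. (cmod (w q r))\<^sup>2) = 0"
      proof (rule antisym)
        show "0 \<le> (\<Sum>q<n. \<Sum>r<n. (cmod (w q r))\<^sup>2)" by (intro sum_nonneg) auto
      qed (use that tr in simp)
      then have "\<forall>q<n. \<forall>r<n. w q r = 0"
        by (auto simp: sum_nonneg_eq_0_iff sum_nonneg)
      then show ?thesis using w assms(3,4) by simp
    qed
    then show ?thesis by (simp add: tr sum_nonneg)
  qed
  have "P $$ (r, c) = 0" "N $$ (r, c) = 0" using tr[OF P] tr[OF N] t assms(2) by auto
  then show ?thesis using psd_carrier[OF N] assms(3,4) by (simp add: X)
qed

section \<open>The maximally entangled state and the diamond distance\<close>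

definition max_entangled :: "nat \<Rightarrow> complex vec" where
  "max_entangled m = vec (m * m) (\<lambda>r. if r div m = r mod m then complex_of_real (sqrt (1 / m)) else 0)"

lemma max_entangled_index:
  "i < m \<Longrightarrow> k < m \<Longrightarrow> max_entangled m $ (i * m + k) = (if i = k then complex_of_real (sqrt (1 / m)) else 0)"
  by (simp add: max_entangled_def prod_index_less)

lemma max_entangled_carrier: "max_entangled m \<in> carrier_vec (m * m)"
  by (simp add: max_entangled_def)

lemma density_max_entangled:
  assumes "0 < m" shows "density_operator (m * m) (ket_bra (max_entangled m))"
proof -
  have "(\<Sum>r<m * m. (cmod (max_entangled m $ r))\<^sup>2) = (\<Sum>i<m. \<Sum>k<m. if k = i then 1 / m else 0)"
    unfolding sum_prod_index by (intro sum.cong refl) (auto simp: max_entangled_index)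
  then have "(\<Sum>r<m * m. (cmod (max_entangled m $ r))\<^sup>2) = 1" using assms by simp
  then show ?thesis
    using psd_ket_bra[OF max_entangled_carrier]
    by (simp add: density_operator_def trace_ket_bra carrier_vecD[OF max_entangled_carrier])
qed

text \<open>A real supremum bounds its members only if the set is bounded. All Schmidt coefficients
  of the maximally entangled state are 1/m, so \<open>trace_dist_le_schmidt\<close> bounds every
  distance by m times the one for this state.\<close>

lemma diamond_dist_upper:
  assumes ch: "channel m m' \<Lambda>\<^sub>0" "channel m m' \<Lambda>\<^sub>1" and m: "0 < m"
    and \<rho>: "density_operator (m * m) \<rho>"
  shows "trace_dist (apply_fst m m' m \<Lambda>\<^sub>0 \<rho>) (apply_fst m m' m \<Lambda>\<^sub>1 \<rho>) \<le> diamond_dist m m' \<Lambda>\<^sub>0 \<Lambda>\<^sub>1"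
  unfolding diamond_dist_def
proof (rule cSUP_upper)
  let ?\<delta> = "\<lambda>q i. if q = i then 1 else (0 :: complex)"
  have "trace_dist (apply_fst m m' m \<Lambda>\<^sub>0 \<rho>) (apply_fst m m' m \<Lambda>\<^sub>1 \<rho>)
      \<le> trace_dist (apply_fst m m' m \<Lambda>\<^sub>0 (ket_bra (max_entangled m)))
          (apply_fst m m' m \<Lambda>\<^sub>1 (ket_bra (max_entangled m))) / (1 / m)"
    if "density_operator (m * m) \<rho>" for \<rho>
  proof (rule trace_dist_le_schmidt[OF ch max_entangled_carrier])
    show "max_entangled m $ (i * m + k) = (\<Sum>q<m. complex_of_real (sqrt (1 / m)) * ?\<delta> q i * ?\<delta> q k)"
      if "i < m" "k < m" for i k
    proof -
      have "(\<Sum>q<m. complex_of_real (sqrt (1 / m)) * ?\<delta> q i * ?\<delta> q k)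
          = (\<Sum>q<m. if q = i then if i = k then complex_of_real (sqrt (1 / m)) else 0 else 0)"
        by (intro sum.cong refl) auto
      then show ?thesis using that by (simp add: max_entangled_index)
    qed
    have on: "(\<Sum>r<m. ?\<delta> i r * cnj (?\<delta> j r)) = (if i = j then 1 else 0)" if "i < m" "j < m" for i j
    proof -
      have "(\<Sum>r<m. ?\<delta> i r * cnj (?\<delta> j r)) = (\<Sum>r<m. if r = i then if i = j then 1 else 0 else 0)"
        by (intro sum.cong refl) auto
      then show ?thesis using that by simp
    qed
    show "orthonormal_basis m ?\<delta>" by (rule orthonormal_basisI) (rule on)
    show "(\<Sum>k<m. ?\<delta> q k * cnj (?\<delta> q' k)) = (if q = q' then 1 else 0)" if "q < m" "q' < m" for q q'
      using that by (rule on)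
  qed (use m that in auto)
  then show "bdd_above ((\<lambda>\<rho>. trace_dist (apply_fst m m' m \<Lambda>\<^sub>0 \<rho>) (apply_fst m m' m \<Lambda>\<^sub>1 \<rho>))
      ` {\<rho>. density_operator (m * m) \<rho>})"
    unfolding bdd_above_def by blast
qed (use \<rho> in simp)

text \<open>Otherwise the two outputs for the maximally entangled state coincide. Up to the factor
  1/m they are the Choi matrices, which determine the maps. Without positivity a quotient by 0 would
  put a spurious 0 into the infimum.\<close>

lemma diamond_dist_pos:
  assumes d: "distinct_channels m m' \<Lambda>\<^sub>0 \<Lambda>\<^sub>1" and m: "0 < m"
  shows "0 < diamond_dist m m' \<Lambda>\<^sub>0 \<Lambda>\<^sub>1"
proof (rule ccontr)
  assume neg: "\<not> 0 < diamond_dist m m' \<Lambda>\<^sub>0 \<Lambda>\<^sub>1"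
  have ch: "channel m m' \<Lambda>\<^sub>0" "channel m m' \<Lambda>\<^sub>1" using d by (auto simp: distinct_channels_def)
  then have L: "linear_map m m' \<Lambda>\<^sub>0" "linear_map m m' \<Lambda>\<^sub>1" by (auto simp: channel_def)
  let ?\<rho> = "ket_bra (max_entangled m)"
  have split: "trace_split (m' * m) (apply_fst m m' m \<Lambda>\<^sub>0 ?\<rho> - apply_fst m m' m \<Lambda>\<^sub>1 ?\<rho>)
    (2 * trace_dist (apply_fst m m' m \<Lambda>\<^sub>0 ?\<rho>) (apply_fst m m' m \<Lambda>\<^sub>1 ?\<rho>))"
    by (rule apply_fst_diff_split(1)[OF ch psd_ket_bra[OF max_entangled_carrier]])
  have le: "2 * trace_dist (apply_fst m m' m \<Lambda>\<^sub>0 ?\<rho>) (apply_fst m m' m \<Lambda>\<^sub>1 ?\<rho>) \<le> 0"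
    using diamond_dist_upper[OF ch m density_max_entangled[OF m]] neg by simp
  have eq: "\<Lambda>\<^sub>0 (matrix_unit m i j) $$ (x, y) = \<Lambda>\<^sub>1 (matrix_unit m i j) $$ (x, y)"
    if "i < m" "j < m" "x < m'" "y < m'" for i j x y
  proof -
    let ?D = "\<lambda>a b. \<Lambda>\<^sub>0 (matrix_unit m a b) $$ (x, y) - \<Lambda>\<^sub>1 (matrix_unit m a b) $$ (x, y)"
    \<comment> \<open>The ancilla indices i and j select the image of the matrix unit (i, j), with
      weight 1/m.\<close>
    have "0 = (apply_fst m m' m \<Lambda>\<^sub>0 ?\<rho> - apply_fst m m' m \<Lambda>\<^sub>1 ?\<rho>) $$ (x * m + i, y * m + j)"
      using trace_split_nonpos[OF split le] prod_index_less that by metis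
    also have "\<dots> = (\<Sum>a<m. \<Sum>b<m. ?\<rho> $$ (a * m + i, b * m + j) * ?D a b)"
      by (rule apply_fst_diff_entry[OF L that(3,4,1,2)])
    also have "\<dots> = (\<Sum>a<m. if a = i then (\<Sum>b<m. if b = j then 1 / m * ?D i j else 0) else 0)"
    proof (intro sum.cong refl)
      fix a assume a: "a \<in> {..<m}"
      have "?\<rho> $$ (a * m + i, b * m + j) = (if a = i \<and> b = j then 1 / m else 0)" if "b < m" for b
        using that a \<open>i < m\<close> \<open>j < m\<close>
        by (simp add: carrier_vecD[OF max_entangled_carrier] prod_index_less max_entangled_index
            flip: of_real_mult)
      then have "(\<Sum>b<m. ?\<rho> $$ (a * m + i, b * m + j) * ?D a b)
        = (\<Sum>b<m. if a = i then if b = j then 1 / m * ?D i j else 0 else 0)"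
        by (intro sum.cong refl) simp
      then show "(\<Sum>b<m. ?\<rho> $$ (a * m + i, b * m + j) * ?D a b)
        = (if a = i then (\<Sum>b<m. if b = j then 1 / m * ?D i j else 0) else 0)"
        by simp
    qed
    also have "\<dots> = 1 / m * ?D i j" using that by simp
    finally show ?thesis using m by simp
  qed
  have "\<Lambda>\<^sub>0 X = \<Lambda>\<^sub>1 X" if X: "X \<in> carrier_mat m m" for X
  proof (rule eq_matI)
    have c: "\<Lambda>\<^sub>0 X \<in> carrier_mat m' m'" "\<Lambda>\<^sub>1 X \<in> carrier_mat m' m'"
      using L X by (auto simp: linear_map_def)
    then show "dim_row (\<Lambda>\<^sub>0 X) = dim_row (\<Lambda>\<^sub>1 X)" "dim_col (\<Lambda>\<^sub>0 X) = dim_col (\<Lambda>\<^sub>1 X)" by auto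
    fix x y assume "x < dim_row (\<Lambda>\<^sub>1 X)" "y < dim_col (\<Lambda>\<^sub>1 X)"
    then show "\<Lambda>\<^sub>0 X $$ (x, y) = \<Lambda>\<^sub>1 X $$ (x, y)"
      using c by (simp add: linear_map_entry[OF L(1) X] linear_map_entry[OF L(2) X] eq)
  qed
  then show False using d by (auto simp: distinct_channels_def)
qed

lemma diamond_dist_least:
  assumes m: "0 < m"
    and "\<And>\<rho>. density_operator (m * m) \<rho> \<Longrightarrow>
      trace_dist (apply_fst m m' m \<Lambda>\<^sub>0 \<rho>) (apply_fst m m' m \<Lambda>\<^sub>1 \<rho>) \<le> t"
  shows "diamond_dist m m' \<Lambda>\<^sub>0 \<Lambda>\<^sub>1 \<le> t"
  unfolding diamond_dist_def
  \<comment> \<open>The maximally entangled state shows that the set is nonempty, as a least upper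
    bound on the reals requires.\<close>
  using density_max_entangled[OF m] assms(2) by (intro cSUP_least) auto

section \<open>Channels that measure an orthonormal basis\<close>

text \<open>X is sent to the sum over l of <u_l, X u_l> |f l><f l|: measure in the basis u and
  record the label \<open>f l\<close> of the outcome in a classical bit. Constant f gives a constant
  channel, the indicator of l0 gives the test for u_l0.\<close>

definition basis_measurement ::
  "nat \<Rightarrow> (nat \<Rightarrow> nat \<Rightarrow> complex) \<Rightarrow> (nat \<Rightarrow> nat) \<Rightarrow> complex mat \<Rightarrow> complex mat" where
  "basis_measurement m u f X =
     mat 2 2 (\<lambda>(x, y). \<Sum>l<m. if f l = x \<and> f l = y then quad_form m X (u l) else 0)"

lemma basis_measurement_index:
  "x < 2 \<Longrightarrow> y < 2 \<Longrightarrow> basis_measurement m u f X $$ (x, y)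
    = (\<Sum>l<m. if f l = x \<and> f l = y then quad_form m X (u l) else 0)"
  by (simp add: basis_measurement_def)

text \<open>Two families of vectors occur because a block of a positive matrix with different
  ancilla indices is a mixed Gram product.\<close>

lemma quad_form_gram_block:
  assumes "\<And>i j. i < m \<Longrightarrow> j < m \<Longrightarrow> M $$ (i, j) = (\<Sum>q\<in>Q. v q i * cnj (w q j))"
  shows "quad_form m M f = (\<Sum>q\<in>Q. (\<Sum>i<m. cnj (f i) * v q i) * cnj (\<Sum>i<m. cnj (f i) * w q i))"
proof -
  have "quad_form m M f = (\<Sum>i<m. \<Sum>j<m. \<Sum>q\<in>Q. (cnj (f i) * v q i) * cnj (cnj (f j) * w q j))"
    unfolding quad_form_def
    by (intro sum.cong refl) (simp add: assms sum_distrib_left sum_distrib_right mult_ac)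
  also have "\<dots> = (\<Sum>i<m. \<Sum>q\<in>Q. \<Sum>j<m. (cnj (f i) * v q i) * cnj (cnj (f j) * w q j))"
    by (intro sum.cong[OF refl] sum.swap)
  also have "\<dots> = (\<Sum>q\<in>Q. \<Sum>i<m. \<Sum>j<m. (cnj (f i) * v q i) * cnj (cnj (f j) * w q j))"
    by (rule sum.swap)
  also have "\<dots> = (\<Sum>q\<in>Q. (\<Sum>i<m. cnj (f i) * v q i) * cnj (\<Sum>i<m. cnj (f i) * w q i))"
    by (intro sum.cong refl) (subst cnj_sum, subst sum_product, simp)
  finally show ?thesis .
qed

text \<open>The trace is preserved because every outcome carries exactly one of the labels 0 and 1.
  For complete positivity, Gram vectors w_q of the input give Gram vectors |f l> (x) (<u_l| (x) 1)
  w_q of the output, indexed by l and q.\<close>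

lemma channel_basis_measurement:
  assumes u: "orthonormal_basis m u" and f: "\<And>l. f l < 2"
  shows "channel m 2 (basis_measurement m u f)"
  unfolding channel_def
proof (intro conjI)
  show "linear_map m 2 (basis_measurement m u f)"
    unfolding linear_map_def
  proof (intro conjI ballI allI)
    fix X Y :: "complex mat" and c
    assume X: "X \<in> carrier_mat m m"
    show "basis_measurement m u f X \<in> carrier_mat 2 2" by (simp add: basis_measurement_def)
    have sm: "quad_form m (c \<cdot>\<^sub>m X) g = c * quad_form m X g" for g
      using X by (simp add: quad_form_def sum_distrib_left mult_ac)
    have "(\<Sum>l<m. if f l = x \<and> f l = y then quad_form m (c \<cdot>\<^sub>m X) (u l) else 0)
        = c * (\<Sum>l<m. if f l = x \<and> f l = y then quad_form m X (u l) else 0)" for x y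
      unfolding sum_distrib_left by (intro sum.cong refl) (simp add: sm)
    then show "basis_measurement m u f (c \<cdot>\<^sub>m X) = c \<cdot>\<^sub>m basis_measurement m u f X"
      by (intro eq_matI) (auto simp: basis_measurement_def)
    assume Y: "Y \<in> carrier_mat m m"
    have ad: "quad_form m (X + Y) g = quad_form m X g + quad_form m Y g" for g
      using X Y by (simp add: quad_form_def algebra_simps sum.distrib)
    have "(\<Sum>l<m. if f l = x \<and> f l = y then quad_form m (X + Y) (u l) else 0)
        = (\<Sum>l<m. if f l = x \<and> f l = y then quad_form m X (u l) else 0)
        + (\<Sum>l<m. if f l = x \<and> f l = y then quad_form m Y (u l) else 0)" for x y
      unfolding sum.distrib[symmetric] by (intro sum.cong refl) (simp add: ad)
    then show "basis_measurement m u f (X + Y) = basis_measurement m u f X + basis_measurement m u f Y"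
      by (intro eq_matI) (auto simp: basis_measurement_def)
  qed
  show "trace_preserving m (basis_measurement m u f)"
    unfolding trace_preserving_def
  proof
    fix X :: "complex mat" assume X: "X \<in> carrier_mat m m"
    have "mat_trace (basis_measurement m u f X)
        = (\<Sum>x<2. \<Sum>l<m. if f l = x then quad_form m X (u l) else 0)"
      by (simp add: mat_trace_def basis_measurement_def)
    also have "\<dots> = (\<Sum>l<m. \<Sum>x<2. if x = f l then quad_form m X (u l) else 0)"
      by (subst sum.swap) (intro sum.cong refl, auto)
    also have "\<dots> = (\<Sum>l<m. quad_form m X (u l))" using f by simp
    finally show "mat_trace (basis_measurement m u f X) = mat_trace X"
      using sum_quad_form_basis[OF u X] by simp
  qed
  show "completely_positive m 2 (basis_measurement m u f)"
    unfolding completely_positive_def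
  proof (intro allI impI)
    fix n M assume M: "psd (m * n) M"
    obtain w where w: "\<And>r c. r < m * n \<Longrightarrow> c < m * n \<Longrightarrow> M $$ (r, c) = (\<Sum>q<m * n. w q r * cnj (w q c))"
      using psd_gramE[OF M] by blast
    define z where "z = (\<lambda>l q k. \<Sum>i<m. cnj (u l i) * w q (i * n + k))"
    show "psd (2 * n) (apply_fst m 2 n (basis_measurement m u f) M)"
    proof (rule psd_gramI[where J = "{..<m} \<times> {..<m * n}"
          and w = "\<lambda>(l, q) r. if f l = r div n then z l q (r mod n) else 0"])
      fix r c assume r: "r < 2 * n" and c: "c < 2 * n"
      obtain x k where rx: "r = x * n + k" "x < 2" "k < n" using r by (rule prod_index_cases)
      obtain y k' where cy: "c = y * n + k'" "y < 2" "k' < n" using c by (rule prod_index_cases)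
      have qf: "quad_form m (mat m m (\<lambda>(i, j). M $$ (i * n + k, j * n + k'))) (u l)
          = (\<Sum>q<m * n. z l q k * cnj (z l q k'))" for l
        unfolding z_def using rx cy by (intro quad_form_gram_block) (simp add: w prod_index_less)
      have "apply_fst m 2 n (basis_measurement m u f) M $$ (r, c)
          = (\<Sum>l<m. \<Sum>q<m * n. if f l = x \<and> f l = y then z l q k * cnj (z l q k') else 0)"
        unfolding rx(1) cy(1) apply_fst_index[OF rx(2) cy(2) rx(3) cy(3)] basis_measurement_index[OF rx(2) cy(2)]
      proof (intro sum.cong refl)
        fix l
        show "(if f l = x \<and> f l = y then quad_form m (mat m m (\<lambda>(i, j). M $$ (i * n + k, j * n + k'))) (u l) else 0)
          = (\<Sum>q<m * n. if f l = x \<and> f l = y then z l q k * cnj (z l q k') else 0)"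
        proof (cases "f l = x \<and> f l = y")
          case True
          then show ?thesis by (auto simp: qf)
        next
          case False
          then show ?thesis by (simp only: if_False sum.neutral_const)
        qed
      qed
      also have "\<dots> = (\<Sum>l<m. \<Sum>q<m * n. (if f l = r div n then z l q (r mod n) else 0)
          * cnj (if f l = c div n then z l q (c mod n) else 0))"
        using rx cy by (intro sum.cong refl) auto
      finally show "apply_fst m 2 n (basis_measurement m u f) M $$ (r, c)
          = (\<Sum>j\<in>{..<m} \<times> {..<m * n}. (case j of (l, q) \<Rightarrow> \<lambda>r. if f l = r div n then z l q (r mod n) else 0) r
            * cnj ((case j of (l, q) \<Rightarrow> \<lambda>r. if f l = r div n then z l q (r mod n) else 0) c))"
        by (simp add: sum.cartesian_product case_prod_beta)
    qed simp
  qed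
qed

text \<open>\<open>h\<close> is (<u_l0| (x) 1) \<psi>, and the output difference is (|0><0| -
  |1><1|) (x) h h^dagger. The exact value is wanted because the formula is used in both directions:
  from above for the given state, from below for the diamond distance.\<close>

lemma trace_dist_basis_measurement:
  assumes u: "orthonormal_basis m u" and l0: "l0 < m" and \<psi>: "\<psi> \<in> carrier_vec (m * n)"
  defines "h \<equiv> \<lambda>k. \<Sum>i<m. cnj (u l0 i) * \<psi> $ (i * n + k)"
  shows "trace_dist (apply_fst m 2 n (basis_measurement m u (\<lambda>_. 0)) (ket_bra \<psi>))
      (apply_fst m 2 n (basis_measurement m u (\<lambda>l. if l = l0 then 1 else 0)) (ket_bra \<psi>))
    = (\<Sum>k<n. (cmod (h k))\<^sup>2)"
proof -
  let ?f0 = "\<lambda>_. 0 :: nat" and ?f1 = "\<lambda>l. if l = l0 then 1 else 0 :: nat"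
  define X where "X = apply_fst m 2 n (basis_measurement m u ?f0) (ket_bra \<psi>)
    - apply_fst m 2 n (basis_measurement m u ?f1) (ket_bra \<psi>)"
  have Xc: "X \<in> carrier_mat (2 * n) (2 * n)" unfolding X_def by (rule minus_carrier_mat) simp
  \<comment> \<open>|z><z| (x) h h^dagger; the one-element sum puts it into Gram form.\<close>
  define P where "P = (\<lambda>z. mat (2 * n) (2 * n) (\<lambda>(r, c).
    \<Sum>q\<in>{()}. (if r div n = z then h (r mod n) else 0) * cnj (if c div n = z then h (c mod n) else 0)))"
  have Pc: "P z \<in> carrier_mat (2 * n) (2 * n)" for z by (simp add: P_def)
  have P: "psd (2 * n) (P z)" for z
    by (rule psd_gramI[OF Pc, where J = "{()}" and w = "\<lambda>_ r. if r div n = z then h (r mod n) else 0"])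
      (simp add: P_def)
  have Pt: "Re (mat_trace (P z)) = (\<Sum>k<n. (cmod (h k))\<^sup>2)" if "z < 2" for z
  proof -
    have "Re (mat_trace (P z)) = (\<Sum>r<2 * n. (cmod (if r div n = z then h (r mod n) else 0))\<^sup>2)"
      by (subst trace_rank_one_sum[OF Pc, where J = "{()}" and l = "\<lambda>_. 1"
            and w = "\<lambda>_ r. if r div n = z then h (r mod n) else 0"]) (auto simp: P_def)
    also have "\<dots> = (\<Sum>x<2. if x = z then (\<Sum>k<n. (cmod (h k))\<^sup>2) else 0)"
      unfolding sum_prod_index by (intro sum.cong refl) auto
    finally show ?thesis using that by simp
  qed
  have Xe: "X $$ (x * n + k, y * n + k')
      = (if x = y then if x = 0 then h k * cnj (h k') else - (h k * cnj (h k')) else 0)"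
    if "x < 2" "y < 2" "k < n" "k' < n" for x y k k'
  proof -
    define g where "g = (\<lambda>l. quad_form m (mat m m (\<lambda>(i, j). ket_bra \<psi> $$ (i * n + k, j * n + k'))) (u l))"
    have g: "g l0 = h k * cnj (h k')"
    proof -
      have "g l0 = (\<Sum>q\<in>{()}. (\<Sum>i<m. cnj (u l0 i) * \<psi> $ (i * n + k)) * cnj (\<Sum>i<m. cnj (u l0 i) * \<psi> $ (i * n + k')))"
        unfolding g_def using that \<psi> by (intro quad_form_gram_block) (simp add: prod_index_less)
      then show ?thesis by (simp add: h_def)
    qed
    have "X $$ (x * n + k, y * n + k')
        = (\<Sum>l<m. if ?f0 l = x \<and> ?f0 l = y then g l else 0)
          - (\<Sum>l<m. if ?f1 l = x \<and> ?f1 l = y then g l else 0)"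
      using that prod_index_less[OF that(1,3)] prod_index_less[OF that(2,4)]
        carrier_matD[OF apply_fst_carrier[of m 2 n "basis_measurement m u ?f1" "ket_bra \<psi>"]]
      by (simp only: X_def index_minus_mat apply_fst_index basis_measurement_index g_def)
    \<comment> \<open>Outcomes other than l0 have the same label in both channels and
      cancel.\<close>
    also have "\<dots> = (\<Sum>l<m. if l = l0 then if x = y then if x = 0 then g l0 else - g l0 else 0 else 0)"
      unfolding sum_subtractf[symmetric] using that by (intro sum.cong refl) (auto simp: less_2_cases_iff)
    also have "\<dots> = (if x = y then if x = 0 then g l0 else - g l0 else 0)" using l0 by simp
    finally show ?thesis by (simp add: g)
  qed
  have "X = P 0 - P 1"
  proof (rule eq_matI)
    fix r c assume "r < dim_row (P 0 - P 1)" "c < dim_col (P 0 - P 1)"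
    then have r: "r < 2 * n" and c: "c < 2 * n" by (auto simp: P_def)
    obtain x k where rx: "r = x * n + k" "x < 2" "k < n" using r by (rule prod_index_cases)
    obtain y k' where cy: "c = y * n + k'" "y < 2" "k' < n" using c by (rule prod_index_cases)
    have "X $$ (r, c) = (if x = y then if x = 0 then h k * cnj (h k') else - (h k * cnj (h k')) else 0)"
      unfolding rx(1) cy(1) using rx cy by (intro Xe)
    also have "\<dots> = P 0 $$ (r, c) - P 1 $$ (r, c)"
      using r c rx cy by (auto simp: P_def less_2_cases_iff)
    finally show "X $$ (r, c) = (P 0 - P 1) $$ (r, c)" using r c by (simp add: P_def)
  qed (use Xc in \<open>auto simp: P_def\<close>)
  then have "trace_split (2 * n) X (2 * (\<Sum>k<n. (cmod (h k))\<^sup>2))"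
    unfolding trace_split_def using P Pt by (intro exI[of _ "P 0"] exI[of _ "P 1"]) simp
  then have le: "trace_norm X \<le> 2 * (\<Sum>k<n. (cmod (h k))\<^sup>2)" by (rule trace_norm_le)
  have ch: "channel m 2 (basis_measurement m u ?f0)" "channel m 2 (basis_measurement m u ?f1)"
    by (auto intro!: channel_basis_measurement[OF u])
  have "trace_split (2 * n) X (trace_norm X)"
    using apply_fst_diff_split(1)[OF ch psd_ket_bra[OF \<psi>]] by (simp add: trace_dist_def X_def)
  \<comment> \<open>The diagonal alone already contributes twice the squared norm of h, so the bound
    \<open>le\<close> is attained.\<close>
  then have "(\<Sum>r<2 * n. cmod (X $$ (r, r))) \<le> trace_norm X" by (rule trace_split_diagonal)
  moreover have "(\<Sum>r<2 * n. cmod (X $$ (r, r))) = (\<Sum>x<2 :: nat. \<Sum>k<n. (cmod (h k))\<^sup>2)"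
    unfolding sum_prod_index by (intro sum.cong refl) (auto simp: Xe norm_mult power2_eq_square)
  ultimately have "trace_norm X = 2 * (\<Sum>k<n. (cmod (h k))\<^sup>2)" using le by simp
  then show ?thesis by (simp add: trace_dist_def X_def)
qed

text \<open>The diamond distance of the two measurement channels is at least 1, so dividing by it
  can only decrease the overlap.\<close>

lemma discrimination_ratio_le_overlap:
  assumes u: "orthonormal_basis m u" and l0: "l0 < m" and \<psi>: "\<psi> \<in> carrier_vec (m * n)"
  shows "\<exists>\<Lambda>\<^sub>0 \<Lambda>\<^sub>1. distinct_channels m 2 \<Lambda>\<^sub>0 \<Lambda>\<^sub>1 \<and>
    trace_dist (apply_fst m 2 n \<Lambda>\<^sub>0 (ket_bra \<psi>)) (apply_fst m 2 n \<Lambda>\<^sub>1 (ket_bra \<psi>)) / diamond_dist m 2 \<Lambda>\<^sub>0 \<Lambda>\<^sub>1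
      \<le> (\<Sum>k<n. (cmod (\<Sum>i<m. cnj (u l0 i) * \<psi> $ (i * n + k)))\<^sup>2)"
proof -
  let ?\<Lambda>0 = "basis_measurement m u (\<lambda>_. 0)"
  let ?\<Lambda>1 = "basis_measurement m u (\<lambda>l. if l = l0 then 1 else 0)"
  have m: "0 < m" using l0 by simp
  have ch: "channel m 2 ?\<Lambda>0" "channel m 2 ?\<Lambda>1"
    by (auto intro!: channel_basis_measurement[OF u])
  have on: "(\<Sum>i<m. cnj (u l0 i) * u l0 i) = 1"
    using u l0 by (simp add: orthonormal_basis_def mult.commute)
  have "distinct_channels m 2 ?\<Lambda>0 ?\<Lambda>1"
    unfolding distinct_channels_def
  proof (intro conjI ch bexI)
    \<comment> \<open>The projection onto u_l0 is always labelled 1 by one channel and always 0 by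
      the other; entry (1, 1) shows the difference.\<close>
    let ?X = "mat m m (\<lambda>(i, j). u l0 i * cnj (u l0 j))"
    show "?X \<in> carrier_mat m m" by simp
    have "quad_form m ?X (u l0) = (\<Sum>q\<in>{()}. (\<Sum>i<m. cnj (u l0 i) * u l0 i) * cnj (\<Sum>i<m. cnj (u l0 i) * u l0 i))"
      by (intro quad_form_gram_block) simp
    then have q: "quad_form m ?X (u l0) = 1" by (simp only: on) simp
    have one_less_two: "(1 :: nat) < 2" by simp
    have "?\<Lambda>1 ?X $$ (1, 1) = (\<Sum>l<m. if l = l0 then quad_form m ?X (u l0) else 0)"
      unfolding basis_measurement_index[OF one_less_two one_less_two]
      by (intro sum.cong refl) auto
    moreover have "?\<Lambda>0 ?X $$ (1, 1) = 0"
      by (simp add: basis_measurement_def)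
    ultimately show "?\<Lambda>0 ?X \<noteq> ?\<Lambda>1 ?X" using q l0 by auto
  qed
  moreover have "1 \<le> diamond_dist m 2 ?\<Lambda>0 ?\<Lambda>1"
  proof -
    \<comment> \<open>The product state of u_l0 and ancilla vector e_0, for which the overlap vector
      h is e_0, of norm 1.\<close>
    define \<phi> where "\<phi> = vec (m * m) (\<lambda>r. if r mod m = 0 then u l0 (r div m) else 0)"
    have \<phi>c: "\<phi> \<in> carrier_vec (m * m)" by (simp add: \<phi>_def)
    have \<phi>: "\<phi> $ (i * m + k) = (if k = 0 then u l0 i else 0)" if "i < m" "k < m" for i k
      using that by (simp add: \<phi>_def prod_index_less)
    have h: "(\<Sum>i<m. cnj (u l0 i) * \<phi> $ (i * m + k)) = (if k = 0 then 1 else 0)" if "k < m" for k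
      using that on by (simp add: \<phi>)
    have "(\<Sum>r<m * m. (cmod (\<phi> $ r))\<^sup>2) = (\<Sum>i<m. \<Sum>k<m. if k = 0 then (cmod (u l0 i))\<^sup>2 else 0)"
      unfolding sum_prod_index by (intro sum.cong refl) (auto simp: \<phi>)
    also have "\<dots> = (\<Sum>i<m. (cmod (u l0 i))\<^sup>2)" using m by simp
    also have "complex_of_real \<dots> = 1"
      unfolding on[symmetric] of_real_sum by (intro sum.cong refl) (simp only: mult_cnj_norm mult.commute[of "cnj _"])
    finally have "density_operator (m * m) (ket_bra \<phi>)"
      using psd_ket_bra[OF \<phi>c] by (simp add: density_operator_def trace_ket_bra carrier_vecD[OF \<phi>c])
    then have "trace_dist (apply_fst m 2 m ?\<Lambda>0 (ket_bra \<phi>)) (apply_fst m 2 m ?\<Lambda>1 (ket_bra \<phi>))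
        \<le> diamond_dist m 2 ?\<Lambda>0 ?\<Lambda>1"
      by (rule diamond_dist_upper[OF ch m])
    moreover have "(\<Sum>k<m. (cmod (\<Sum>i<m. cnj (u l0 i) * \<phi> $ (i * m + k)))\<^sup>2) = (\<Sum>k<m. if k = 0 then 1 else 0)"
      by (intro sum.cong refl) (simp add: h)
    ultimately show ?thesis
      unfolding trace_dist_basis_measurement[OF u l0 \<phi>c] using m by simp
  qed
  moreover have "s / t \<le> s" if "1 \<le> t" "0 \<le> s" for s t :: real
    using that by (simp add: divide_le_eq mult_le_cancel_left1)
  ultimately show ?thesis
    using trace_dist_basis_measurement[OF u l0 \<psi>]
    by (intro exI[of _ ?\<Lambda>0] exI[of _ ?\<Lambda>1]) (auto simp: sum_nonneg)
qed

section \<open>Channel discrimination power of Schmidt decompositions\<close>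

text \<open>Q is the projection onto the span of the v_q, and the vector is sought in an eigenbasis
  of Q. If each eigenvector overlapped with some v_q, all eigenvalues would be 1 and the trace of Q
  would be d instead of r.\<close>

lemma orthonormal_complement_vector:
  assumes r: "r < d"
    and v: "\<And>q q'. q < r \<Longrightarrow> q' < r \<Longrightarrow> (\<Sum>i<d. v q i * cnj (v q' i)) = (if q = q' then 1 else 0)"
  obtains u l where "orthonormal_basis d u" "l < d" "\<And>q. q < r \<Longrightarrow> (\<Sum>i<d. cnj (u l i) * v q i) = 0"
proof -
  define Q where "Q = mat d d (\<lambda>(i, j). \<Sum>q<r. v q i * cnj (v q j))"
  have Qc: "Q \<in> carrier_mat d d" by (simp add: Q_def)
  have "psd d Q" by (rule psd_gramI[OF Qc, where J = "{..<r}" and w = v]) (simp add: Q_def)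
  then obtain u e where u: "orthonormal_basis d u"
    and sp: "\<And>i j. i < d \<Longrightarrow> j < d \<Longrightarrow> Q $$ (i, j) = (\<Sum>k<d. complex_of_real (e k) * u k i * cnj (u k j))"
    using hermitian_spectral[OF Qc psd_hermitian] by blast
  have "\<exists>l<d. \<forall>q<r. (\<Sum>i<d. cnj (u l i) * v q i) = 0"
  proof (rule ccontr)
    assume neg: "\<not> (\<exists>l<d. \<forall>q<r. (\<Sum>i<d. cnj (u l i) * v q i) = 0)"
    have "e l = 1" if l: "l < d" for l
    proof -
      define z where "z = (\<lambda>q. \<Sum>j<d. cnj (v q j) * u l j)"
      obtain q where q: "q < r" "(\<Sum>i<d. cnj (u l i) * v q i) \<noteq> 0" using neg l by blast
      have "cnj (z q) = (\<Sum>i<d. cnj (u l i) * v q i)" by (simp add: z_def mult.commute)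
      then have z0: "z q \<noteq> 0" using q(2) by auto
      have Qu: "complex_of_real (e l) * u l i = (\<Sum>q'<r. v q' i * z q')" if i: "i < d" for i
      proof -
        have "complex_of_real (e l) * u l i = (\<Sum>j<d. Q $$ (i, j) * u l j)"
          using orthonormal_basis_spectral_value(2)[OF u sp l i] by simp
        also have "\<dots> = (\<Sum>j<d. \<Sum>q'<r. v q' i * (cnj (v q' j) * u l j))"
          using i by (intro sum.cong refl) (simp add: Q_def sum_distrib_right sum_distrib_left mult_ac)
        also have "\<dots> = (\<Sum>q'<r. v q' i * z q')"
          unfolding z_def by (subst sum.swap) (simp add: sum_distrib_left)
        finally show ?thesis .
      qed
      \<comment> \<open>The eigenvalue equation is paired with v_q, which Q fixes; a nonzero overlap
        \<open>z q\<close> then forces the eigenvalue 1.\<close>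
      have "complex_of_real (e l) * z q = (\<Sum>i<d. cnj (v q i) * (complex_of_real (e l) * u l i))"
        by (simp add: z_def sum_distrib_left mult_ac)
      also have "\<dots> = (\<Sum>i<d. \<Sum>q'<r. z q' * (v q' i * cnj (v q i)))"
        by (intro sum.cong refl) (simp add: Qu sum_distrib_left mult_ac)
      also have "\<dots> = (\<Sum>q'<r. z q' * (\<Sum>i<d. v q' i * cnj (v q i)))"
        by (subst sum.swap) (simp add: sum_distrib_left)
      also have "\<dots> = (\<Sum>q'<r. if q' = q then z q else 0)"
        using q(1) by (intro sum.cong refl) (simp add: v)
      also have "\<dots> = z q" using q(1) by simp
      finally show "e l = 1" using z0 by simp
    qed
    then have "mat_trace Q = (\<Sum>l<d. 1)"
      unfolding sum_quad_form_basis[OF u Qc, symmetric]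
      by (intro sum.cong refl) (simp add: orthonormal_basis_spectral_value(1)[OF u sp])
    moreover have "mat_trace Q = (\<Sum>q<r. 1)"
    proof -
      have "mat_trace Q = (\<Sum>i<d. \<Sum>q<r. v q i * cnj (v q i))" by (simp add: mat_trace_def Q_def)
      also have "\<dots> = (\<Sum>q<r. \<Sum>i<d. v q i * cnj (v q i))" by (rule sum.swap)
      finally show ?thesis by (simp add: v)
    qed
    ultimately show False using r by simp
  qed
  then show ?thesis using that u by blast
qed

lemma schmidt_vectors_orthonormal:
  assumes "orthonormal_family d {1..r} a" "q < r" "q' < r"
  shows "(\<Sum>i<d. a (Suc q) $ i * cnj (a (Suc q') $ i)) = (if q = q' then 1 else 0)"
proof -
  have a: "a (Suc q') \<in> carrier_vec d" "a (Suc q) \<bullet>c a (Suc q') = (if Suc q = Suc q' then 1 else 0)"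
    using assms unfolding orthonormal_family_def by auto
  have "a (Suc q) \<bullet>c a (Suc q') = (\<Sum>i<d. a (Suc q) $ i * cnj (a (Suc q') $ i))"
    using a(1) by (simp add: scalar_prod_def lessThan_atLeast0)
  then show ?thesis using a(2) by simp
qed

text \<open>The Schmidt terms are numbered from 1, bases here from 0: index q stands for term
  \<open>Suc q\<close>.\<close>

lemma schmidt_entry:
  assumes sd: "schmidt_decomposition dA dB \<psi> r p a b"
  shows "\<psi> \<in> carrier_vec (dA * dB)"
    and "i < dA \<Longrightarrow> k < dB \<Longrightarrow>
      \<psi> $ (i * dB + k) = (\<Sum>q<r. complex_of_real (sqrt (p (Suc q))) * a (Suc q) $ i * b (Suc q) $ k)"
proof -
  let ?t = "\<lambda>i. complex_of_real (sqrt (p i)) \<cdot>\<^sub>v tensor_vec (a i) (b i)"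
  have \<psi>: "\<psi> = finsum_vec TYPE(complex) (dA * dB) ?t {1..r}"
    and ab: "\<And>i. i \<in> {1..r} \<Longrightarrow> dim_vec (a i) = dA" "\<And>i. i \<in> {1..r} \<Longrightarrow> dim_vec (b i) = dB"
    using sd by (auto simp: schmidt_decomposition_def orthonormal_family_def)
  have t: "?t \<in> {1..r} \<rightarrow> carrier_vec (dA * dB)"
  proof
    fix i assume "i \<in> {1..r}"
    then show "?t i \<in> carrier_vec (dA * dB)" by (intro carrier_vecI) (simp add: tensor_vec_def ab)
  qed
  then show "\<psi> \<in> carrier_vec (dA * dB)" unfolding \<psi> by (rule finsum_vec_closed)
  assume ik: "i < dA" "k < dB"
  have "\<psi> $ (i * dB + k) = (\<Sum>q\<in>{1..r}. ?t q $ (i * dB + k))"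
    unfolding \<psi> by (rule index_finsum_vec) (use t prod_index_less[OF ik] in auto)
  also have "\<dots> = (\<Sum>q\<in>{1..r}. complex_of_real (sqrt (p q)) * a q $ i * b q $ k)"
    using prod_index_less[OF ik] ik ab by (intro sum.cong refl) (simp add: tensor_vec_def)
  finally show "\<psi> $ (i * dB + k) = (\<Sum>q<r. complex_of_real (sqrt (p (Suc q))) * a (Suc q) $ i * b (Suc q) $ k)"
    by (simp add: sum.atLeast1_atMost_eq)
qed

text \<open>If the Schmidt vectors fill A, they serve as the basis, and the overlap with the last
  one is sqrt (p dA) times a unit vector. If r < dA, a vector orthogonal to all of them has overlap
  0, which is also the claimed value.\<close>

lemma schmidt_overlap:
  assumes sd: "schmidt_decomposition dA dB \<psi> r p a b" and dA: "0 < dA"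
  obtains u l where "orthonormal_basis dA u" "l < dA"
    "(\<Sum>k<dB. (cmod (\<Sum>i<dA. cnj (u l i) * \<psi> $ (i * dB + k)))\<^sup>2) = (if dA \<le> dB then p dA else 0)"
proof -
  have r: "r \<le> dA" "r \<le> dB" and a: "orthonormal_family dA {1..r} a" and b: "orthonormal_family dB {1..r} b"
    and p: "\<And>i. i \<in> {1..min dA dB} \<Longrightarrow> 0 \<le> p i" "\<And>i. i \<in> {r<..min dA dB} \<Longrightarrow> p i = 0"
    using sd by (auto simp: schmidt_decomposition_def)
  have ov: "(\<Sum>i<dA. cnj (f i) * \<psi> $ (i * dB + k))
      = (\<Sum>q<r. complex_of_real (sqrt (p (Suc q))) * (\<Sum>i<dA. cnj (f i) * a (Suc q) $ i) * b (Suc q) $ k)"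
    if "k < dB" for f k
  proof -
    have "(\<Sum>i<dA. cnj (f i) * \<psi> $ (i * dB + k))
        = (\<Sum>i<dA. \<Sum>q<r. complex_of_real (sqrt (p (Suc q))) * (cnj (f i) * a (Suc q) $ i) * b (Suc q) $ k)"
      using that by (intro sum.cong refl) (simp add: schmidt_entry(2)[OF sd] sum_distrib_left mult_ac)
    then show ?thesis
      by (subst (asm) sum.swap) (simp add: sum_distrib_left sum_distrib_right mult_ac)
  qed
  show ?thesis
  proof (cases "r = dA")
    case True
    define u where "u = (\<lambda>q i. a (Suc q) $ i)"
    have u: "orthonormal_basis dA u"
      unfolding u_def by (rule orthonormal_basisI) (rule schmidt_vectors_orthonormal[OF a], simp_all add: True)
    \<comment> \<open>Position dA - 1 in the basis is Schmidt vector number dA, the one with the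
      least coefficient.\<close>
    have l: "dA - 1 < dA" "Suc (dA - 1) = dA" using dA by auto
    have "(\<Sum>i<dA. cnj (u (dA - 1) i) * \<psi> $ (i * dB + k)) = complex_of_real (sqrt (p dA)) * b dA $ k"
      if "k < dB" for k
    proof -
      have "(\<Sum>i<dA. cnj (u (dA - 1) i) * a (Suc q) $ i) = (if q = dA - 1 then 1 else 0)" if "q < dA" for q
        using schmidt_vectors_orthonormal[OF a, of q "dA - 1"] that l(1) by (simp add: True u_def mult.commute)
      then have "(\<Sum>i<dA. cnj (u (dA - 1) i) * \<psi> $ (i * dB + k))
          = (\<Sum>q<dA. if q = dA - 1 then complex_of_real (sqrt (p dA)) * b dA $ k else 0)"
        unfolding ov[OF that] True using l(2) by (intro sum.cong refl) auto
      then show ?thesis using l(1) by simp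
    qed
    moreover have "(\<Sum>k<dB. (cmod (b dA $ k))\<^sup>2) = 1"
    proof -
      have "complex_of_real (\<Sum>k<dB. (cmod (b dA $ k))\<^sup>2) = 1"
        using schmidt_vectors_orthonormal[OF b, of "dA - 1" "dA - 1"] l
        unfolding of_real_sum mult_cnj_norm[symmetric] by (simp add: True)
      then show ?thesis by (simp only: of_real_eq_1_iff)
    qed
    moreover have "0 \<le> p dA" "dA \<le> dB" using p(1)[of dA] dA r True by auto
    ultimately have "(\<Sum>k<dB. (cmod (\<Sum>i<dA. cnj (u (dA - 1) i) * \<psi> $ (i * dB + k)))\<^sup>2) = p dA"
      by (simp add: norm_mult power_mult_distrib flip: sum_distrib_left)
    then show ?thesis using that[OF u l(1)] \<open>dA \<le> dB\<close> by simp
  next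
    case False
    then have rA: "r < dA" using r by simp
    show ?thesis
    proof (rule orthonormal_complement_vector[of r dA "\<lambda>q i. a (Suc q) $ i"])
      show "r < dA" by (rule rA)
      show "(\<Sum>i<dA. a (Suc q) $ i * cnj (a (Suc q') $ i)) = (if q = q' then 1 else 0)"
        if "q < r" "q' < r" for q q'
        by (rule schmidt_vectors_orthonormal[OF a that])
      fix u l
      assume u: "orthonormal_basis dA u" "l < dA"
        and ul: "\<And>q. q < r \<Longrightarrow> (\<Sum>i<dA. cnj (u l i) * a (Suc q) $ i) = 0"
      have "(\<Sum>i<dA. cnj (u l i) * \<psi> $ (i * dB + k)) = 0" if "k < dB" for k
        unfolding ov[OF that] by (intro sum.neutral) (simp add: ul)
      \<comment> \<open>For dA <= dB the coefficient number dA lies beyond the r-th and is therefore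
        0; for dA > dB the value is 0 by the case distinction.\<close>
      moreover have "(if dA \<le> dB then p dA else 0) = 0" using p(2)[of dA] rA by simp
      ultimately show thesis using that[OF u] by simp
    qed
  qed
qed

text \<open>One formula covers both orders of the dimensions, so that the same lemma serves for B
  after an exchange. The ordering of the coefficients enters only in the lower bound, where p dA
  must be the least of them.\<close>

lemma CDP_A_schmidt:
  assumes sd: "schmidt_decomposition dA dB \<psi> r p a b" and dA: "0 < dA"
    and mono: "\<And>i j. 1 \<le> i \<Longrightarrow> i \<le> j \<Longrightarrow> j \<le> min dA dB \<Longrightarrow> p j \<le> p i"
  shows "CDP_A dA dB (ket_bra \<psi>) = (if dA \<le> dB then p dA else 0)"
proof -
  define v where "v = (if dA \<le> dB then p dA else 0)"
  define ratio where "ratio d \<Lambda>\<^sub>0 \<Lambda>\<^sub>1 =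
    trace_dist (apply_fst dA d dB \<Lambda>\<^sub>0 (ket_bra \<psi>)) (apply_fst dA d dB \<Lambda>\<^sub>1 (ket_bra \<psi>)) / diamond_dist dA d \<Lambda>\<^sub>0 \<Lambda>\<^sub>1"
    for d \<Lambda>\<^sub>0 \<Lambda>\<^sub>1
  define S where "S = {ratio d \<Lambda>\<^sub>0 \<Lambda>\<^sub>1 | d \<Lambda>\<^sub>0 \<Lambda>\<^sub>1. distinct_channels dA d \<Lambda>\<^sub>0 \<Lambda>\<^sub>1}"
  note \<psi> = schmidt_entry(1)[OF sd]
  have r: "r \<le> dA" "r \<le> dB" and a: "orthonormal_family dA {1..r} a" and b: "orthonormal_family dB {1..r} b"
    and p: "\<And>i. i \<in> {r<..min dA dB} \<Longrightarrow> p i = 0"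
    using sd by (auto simp: schmidt_decomposition_def)
  have nonneg: "0 \<le> ratio d \<Lambda>\<^sub>0 \<Lambda>\<^sub>1" if "distinct_channels dA d \<Lambda>\<^sub>0 \<Lambda>\<^sub>1" for d \<Lambda>\<^sub>0 \<Lambda>\<^sub>1
    using apply_fst_diff_split(2)[OF _ _ psd_ket_bra[OF \<psi>], of d \<Lambda>\<^sub>0 \<Lambda>\<^sub>1] diamond_dist_pos[OF that dA] that
    by (auto simp: ratio_def distinct_channels_def)
  have lower: "v \<le> ratio d \<Lambda>\<^sub>0 \<Lambda>\<^sub>1" if dist: "distinct_channels dA d \<Lambda>\<^sub>0 \<Lambda>\<^sub>1" for d \<Lambda>\<^sub>0 \<Lambda>\<^sub>1
  proof (cases "0 < v")
    \<comment> \<open>The filter divides by the least coefficient; for value 0 nonnegativity of the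
      ratios is all that is claimed.\<close>
    case False
    then show ?thesis using nonneg[OF that] by simp
  next
    case True
    then have le: "dA \<le> dB" and pos: "0 < p dA" and v: "v = p dA" by (auto simp: v_def split: if_splits)
    \<comment> \<open>A positive last coefficient forces all dA terms to be present, hence full
      Schmidt rank on A.\<close>
    have rA: "r = dA" using p[of dA] pos le r(1) by (cases "r = dA") auto
    have ch: "channel dA d \<Lambda>\<^sub>0" "channel dA d \<Lambda>\<^sub>1" using dist by (auto simp: distinct_channels_def)
    let ?t = "trace_dist (apply_fst dA d dB \<Lambda>\<^sub>0 (ket_bra \<psi>)) (apply_fst dA d dB \<Lambda>\<^sub>1 (ket_bra \<psi>))"
    have "diamond_dist dA d \<Lambda>\<^sub>0 \<Lambda>\<^sub>1 \<le> ?t / p dA"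
    proof (rule diamond_dist_least[OF dA])
      fix \<rho> assume \<rho>: "density_operator (dA * dA) \<rho>"
      show "trace_dist (apply_fst dA d dA \<Lambda>\<^sub>0 \<rho>) (apply_fst dA d dA \<Lambda>\<^sub>1 \<rho>) \<le> ?t / p dA"
      proof (rule trace_dist_le_schmidt[OF ch \<psi> _ _ _ pos _ \<rho>])
        show "\<psi> $ (i * dB + k) = (\<Sum>q<dA. complex_of_real (sqrt (p (Suc q))) * a (Suc q) $ i * b (Suc q) $ k)"
          if "i < dA" "k < dB" for i k
          using schmidt_entry(2)[OF sd that] by (simp add: rA)
        show "orthonormal_basis dA (\<lambda>q i. a (Suc q) $ i)"
          by (rule orthonormal_basisI) (rule schmidt_vectors_orthonormal[OF a], simp_all add: rA)
        show "(\<Sum>k<dB. b (Suc q) $ k * cnj (b (Suc q') $ k)) = (if q = q' then 1 else 0)"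
          if "q < dA" "q' < dA" for q q'
          by (rule schmidt_vectors_orthonormal[OF b]) (use that rA in auto)
        fix q assume "q < dA"
        then have "p dA \<le> p (Suc q)" using le by (intro mono) auto
        then show "p dA \<le> (sqrt (p (Suc q)))\<^sup>2" using pos by simp
      qed
    qed
    then show ?thesis
      using diamond_dist_pos[OF dist dA] pos by (simp add: v ratio_def field_simps)
  qed
  obtain u l where u: "orthonormal_basis dA u" "l < dA"
    and ul: "(\<Sum>k<dB. (cmod (\<Sum>i<dA. cnj (u l i) * \<psi> $ (i * dB + k)))\<^sup>2) = v"
    unfolding v_def by (rule schmidt_overlap[OF sd dA])
  obtain \<Lambda>\<^sub>0 \<Lambda>\<^sub>1 where \<Lambda>: "distinct_channels dA 2 \<Lambda>\<^sub>0 \<Lambda>\<^sub>1" "ratio 2 \<Lambda>\<^sub>0 \<Lambda>\<^sub>1 \<le> v"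
    using discrimination_ratio_le_overlap[OF u \<psi>, unfolded ul, folded ratio_def] by blast
  have in_S: "ratio 2 \<Lambda>\<^sub>0 \<Lambda>\<^sub>1 \<in> S" unfolding S_def using \<Lambda>(1) by blast
  have "Inf S = v"
  proof (rule antisym)
    \<comment> \<open>An infimum of reals lies below its members only for sets bounded below; 0 is a
      bound.\<close>
    have "bdd_below S" unfolding bdd_below_def S_def using nonneg by blast
    then show "Inf S \<le> v" using cInf_lower[OF in_S] \<Lambda>(2) by linarith
    show "v \<le> Inf S" using in_S lower by (intro cInf_greatest) (auto simp: S_def)
  qed
  then show ?thesis by (simp add: CDP_A_def S_def ratio_def v_def)
qed

section \<open>Exchange of the tensor factors\<close>

text \<open>Conjugation by the flip unitary, done as a permutation of indices; m and n are the
  dimensions of the factors before the exchange.\<close>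

definition swap_factors :: "nat \<Rightarrow> nat \<Rightarrow> complex mat \<Rightarrow> complex mat" where
  "swap_factors m n M = mat (n * m) (n * m)
     (\<lambda>(r, c). M $$ ((r mod m) * n + r div m, (c mod m) * n + c div m))"

lemma swap_factors_carrier [simp]: "swap_factors m n M \<in> carrier_mat (n * m) (n * m)"
  by (simp add: swap_factors_def)

lemma swap_factors_index:
  "i < m \<Longrightarrow> j < m \<Longrightarrow> k < n \<Longrightarrow> l < n \<Longrightarrow>
    swap_factors m n M $$ (k * m + i, l * m + j) = M $$ (i * n + k, j * n + l)"
  by (simp add: swap_factors_def prod_index_less)

lemma eq_mat_prod_index:
  assumes "A \<in> carrier_mat (m * n) (m * n)" "B \<in> carrier_mat (m * n) (m * n)"
    and "\<And>i j k l. i < m \<Longrightarrow> j < m \<Longrightarrow> k < n \<Longrightarrow> l < n \<Longrightarrow>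
      A $$ (i * n + k, j * n + l) = B $$ (i * n + k, j * n + l)"
  shows "A = B"
proof (rule eq_matI)
  fix r c assume "r < dim_row B" "c < dim_col B"
  then have r: "r < m * n" and c: "c < m * n" using assms(2) by auto
  obtain i k where "r = i * n + k" "i < m" "k < n" using r by (rule prod_index_cases)
  moreover obtain j l where "c = j * n + l" "j < m" "l < n" using c by (rule prod_index_cases)
  ultimately show "A $$ (r, c) = B $$ (r, c)" using assms(3) by simp
qed (use assms in auto)

lemma swap_factors_swap:
  "M \<in> carrier_mat (m * n) (m * n) \<Longrightarrow> swap_factors n m (swap_factors m n M) = M"
  by (rule eq_mat_prod_index[of _ m n]) (simp_all add: swap_factors_index)

lemma psd_swap_factors:
  assumes "psd (m * n) M" shows "psd (n * m) (swap_factors m n M)"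
proof -
  obtain w where w: "\<And>r c. r < m * n \<Longrightarrow> c < m * n \<Longrightarrow> M $$ (r, c) = (\<Sum>q<m * n. w q r * cnj (w q c))"
    using psd_gramE[OF assms] by blast
  show ?thesis
  proof (rule psd_gramI[where J = "{..<m * n}" and w = "\<lambda>q r. w q ((r mod m) * n + r div m)"])
    fix r c assume r: "r < n * m" and c: "c < n * m"
    obtain k i where "r = k * m + i" "k < n" "i < m" using r by (rule prod_index_cases)
    moreover obtain l j where "c = l * m + j" "l < n" "j < m" using c by (rule prod_index_cases)
    ultimately show "swap_factors m n M $$ (r, c) = (\<Sum>q<m * n. w q ((r mod m) * n + r div m)
        * cnj (w q ((c mod m) * n + c div m)))"
      by (simp add: swap_factors_index w prod_index_less)
  qed simp
qed

text \<open>Conjugation by a permutation matrix, an isometry, so the constant in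
  \<open>trace_split_conj\<close> is 1. An inequality suffices: exchanging back yields the
  converse.\<close>

lemma trace_norm_swap_factors_le:
  assumes A: "psd (m * n) A" and B: "psd (m * n) B"
  shows "trace_norm (swap_factors m n A - swap_factors m n B) \<le> trace_norm (A - B)"
proof -
  let ?\<sigma> = "\<lambda>r. (r mod m) * n + r div m"
  let ?V = "\<lambda>r s. if s = ?\<sigma> r then 1 else (0 :: complex)"
  have \<sigma>: "?\<sigma> r < m * n" if "r < n * m" for r
    using that by (elim prod_index_cases) (simp add: prod_index_less)
  have V: "(\<Sum>s<m * n. ?V r s * f s) = f (?\<sigma> r)" if "r < n * m" for r and f :: "nat \<Rightarrow> complex"
  proof -
    have "(\<Sum>s<m * n. ?V r s * f s) = (\<Sum>s<m * n. if s = ?\<sigma> r then f (?\<sigma> r) else 0)"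
      by (intro sum.cong refl) auto
    then show ?thesis using \<sigma>[OF that] by simp
  qed
  have "trace_split (n * m) (swap_factors m n A - swap_factors m n B) (1 * trace_norm (A - B))"
  proof (rule trace_split_conj[OF trace_split_trace_norm[OF A B], where V = ?V])
    show "swap_factors m n A - swap_factors m n B \<in> carrier_mat (n * m) (n * m)"
      by (rule minus_carrier_mat) simp
    fix r c assume r: "r < n * m" and c: "c < n * m"
    have "(\<Sum>s<m * n. \<Sum>t<m * n. ?V r s * (A - B) $$ (s, t) * cnj (?V c t))
        = (\<Sum>s<m * n. ?V r s * (\<Sum>t<m * n. ?V c t * (A - B) $$ (s, t)))"
      unfolding sum_distrib_left by (intro sum.cong refl) auto
    also have "\<dots> = (A - B) $$ (?\<sigma> r, ?\<sigma> c)" by (simp only: V[OF r] V[OF c])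
    also have "\<dots> = (swap_factors m n A - swap_factors m n B) $$ (r, c)"
      using r c psd_carrier[OF B] \<sigma>[OF r] \<sigma>[OF c] by (simp add: swap_factors_def)
    finally show "(swap_factors m n A - swap_factors m n B) $$ (r, c)
        = (\<Sum>s<m * n. \<Sum>t<m * n. ?V r s * (A - B) $$ (s, t) * cnj (?V c t))" ..
  next
    fix f :: "nat \<Rightarrow> complex"
    have "(\<Sum>r<n * m. (cmod (\<Sum>s<m * n. ?V r s * f s))\<^sup>2) = (\<Sum>r<n * m. (cmod (f (?\<sigma> r)))\<^sup>2)"
      by (intro sum.cong refl) (simp only: V lessThan_iff)
    also have "\<dots> = (\<Sum>k<n. \<Sum>i<m. (cmod (f (i * n + k)))\<^sup>2)"
      unfolding sum_prod_index by (intro sum.cong refl) simp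
    also have "\<dots> = 1 * (\<Sum>s<m * n. (cmod (f s))\<^sup>2)"
      unfolding sum_prod_index by (subst sum.swap) simp
    finally show "(\<Sum>r<n * m. (cmod (\<Sum>s<m * n. ?V r s * f s))\<^sup>2) \<le> 1 * (\<Sum>s<m * n. (cmod (f s))\<^sup>2)"
      by simp
  qed simp
  then show ?thesis using trace_norm_le by fastforce
qed

lemma trace_dist_swap_factors:
  assumes "psd (m * n) A" "psd (m * n) B"
  shows "trace_dist (swap_factors m n A) (swap_factors m n B) = trace_dist A B"
  using trace_norm_swap_factors_le[OF assms]
    trace_norm_swap_factors_le[OF psd_swap_factors[OF assms(1)] psd_swap_factors[OF assms(2)]]
    assms[THEN psd_carrier]
  by (simp add: trace_dist_def swap_factors_swap)

lemma apply_snd_eq_swap_factors: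
  "apply_snd n m m' \<Lambda> M = swap_factors m' n (apply_fst m m' n \<Lambda> (swap_factors n m M))"
proof (rule eq_mat_prod_index[of _ n m'])
  fix k l x y assume *: "k < n" "l < n" "x < m'" "y < m'"
  have "mat m m (\<lambda>(i, j). swap_factors n m M $$ (i * n + k, j * n + l))
      = mat m m (\<lambda>(i, j). M $$ (k * m + i, l * m + j))"
    using * by (intro eq_matI) (auto simp: swap_factors_index)
  then show "apply_snd n m m' \<Lambda> M $$ (k * m' + x, l * m' + y)
      = swap_factors m' n (apply_fst m m' n \<Lambda> (swap_factors n m M)) $$ (k * m' + x, l * m' + y)"
    using * by (simp add: swap_factors_index apply_fst_index apply_snd_def prod_index_less)
qed (simp_all add: apply_snd_def)

text \<open>Only the numerators have to be compared, since \<open>diamond_dist\<close> puts the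
  channel on the first factor in both definitions; there the exchange of the output factors leaves
  the trace distance unchanged.\<close>

lemma CDP_B_eq_CDP_A:
  assumes \<rho>: "psd (dA * dB) \<rho>"
  shows "CDP_B dA dB \<rho> = CDP_A dB dA (swap_factors dA dB \<rho>)"
proof -
  have "trace_dist (apply_snd dA dB d \<Lambda>\<^sub>0 \<rho>) (apply_snd dA dB d \<Lambda>\<^sub>1 \<rho>)
      = trace_dist (apply_fst dB d dA \<Lambda>\<^sub>0 (swap_factors dA dB \<rho>)) (apply_fst dB d dA \<Lambda>\<^sub>1 (swap_factors dA dB \<rho>))"
    if "distinct_channels dB d \<Lambda>\<^sub>0 \<Lambda>\<^sub>1" for d \<Lambda>\<^sub>0 \<Lambda>\<^sub>1
    unfolding apply_snd_eq_swap_factors using that psd_swap_factors[OF \<rho>]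
    by (intro trace_dist_swap_factors psd_apply_fst) (auto simp: distinct_channels_def)
  then show ?thesis
    unfolding CDP_B_def CDP_A_def
    by (intro arg_cong[where f = Inf] Collect_cong) (simp cong: rev_conj_cong)
qed

text \<open>The conditions on p involve the dimensions only through their minimum, so exchanging the
  families a and b keeps the same coefficients.\<close>

lemma schmidt_decomposition_swap:
  assumes sd: "schmidt_decomposition dA dB \<psi> r p a b"
  obtains \<phi> where "schmidt_decomposition dB dA \<phi> r p b a" "swap_factors dA dB (ket_bra \<psi>) = ket_bra \<phi>"
proof -
  define \<phi> where "\<phi> = finsum_vec TYPE(complex) (dB * dA)
           (\<lambda>i. complex_of_real (sqrt (p i)) \<cdot>\<^sub>v tensor_vec (b i) (a i)) {1..r}"
  have sd': "schmidt_decomposition dB dA \<phi> r p b a"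
    using sd unfolding schmidt_decomposition_def \<phi>_def by (simp add: min.commute)
  have "\<phi> $ (k * dA + i) = \<psi> $ (i * dB + k)" if "k < dB" "i < dA" for i k
    unfolding schmidt_entry(2)[OF sd that(2,1)] schmidt_entry(2)[OF sd' that]
    by (intro sum.cong refl) (simp add: mult_ac)
  then have "swap_factors dA dB (ket_bra \<psi>) = ket_bra \<phi>"
    using schmidt_entry(1)[OF sd] schmidt_entry(1)[OF sd']
    by (intro eq_mat_prod_index[of _ dB dA])
      (auto simp: swap_factors_index prod_index_less ket_bra_def carrier_vecD)
  then show ?thesis using that sd' by blast
qed

theorem theorem1:
  fixes dA dB r :: nat
    and \<psi> :: "complex vec"
    and p :: "nat \<Rightarrow> real"
    and a b :: "nat \<Rightarrow> complex vec"
  assumes "\<psi> \<in> carrier_vec (dA * dB)"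
    and "\<psi> \<bullet>c \<psi> = 1"
    and "schmidt_decomposition dA dB \<psi> r p a b"
    and "\<And>i j. 1 \<le> i \<Longrightarrow> i \<le> j \<Longrightarrow> j \<le> min dA dB \<Longrightarrow> p j \<le> p i"
  shows "(dA = dB \<longrightarrow>
            CDP_A dA dB (ket_bra \<psi>) = p (min dA dB) \<and>
            CDP_B dA dB (ket_bra \<psi>) = p (min dA dB)) \<and>
         (dA < dB \<longrightarrow>
            CDP_A dA dB (ket_bra \<psi>) = p (min dA dB) \<and>
            CDP_B dA dB (ket_bra \<psi>) = 0)"
proof -
  \<comment> \<open>If a dimension were 0, this sum would be empty and could not equal 1.\<close>
  have "(\<Sum>i\<in>{1..min dA dB}. p i) = 1" using assms(3) by (simp add: schmidt_decomposition_def)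
  then have pos: "0 < dA" "0 < dB" by (auto intro!: Nat.gr0I)
  obtain \<phi> where \<phi>: "schmidt_decomposition dB dA \<phi> r p b a"
    and swap: "swap_factors dA dB (ket_bra \<psi>) = ket_bra \<phi>"
    using schmidt_decomposition_swap[OF assms(3)] by blast
  have "CDP_A dA dB (ket_bra \<psi>) = (if dA \<le> dB then p dA else 0)"
    by (rule CDP_A_schmidt[OF assms(3) pos(1) assms(4)])
  moreover have "CDP_A dB dA (ket_bra \<phi>) = (if dB \<le> dA then p dB else 0)"
    by (rule CDP_A_schmidt[OF \<phi> pos(2)]) (simp add: assms(4) min.commute)
  then have "CDP_B dA dB (ket_bra \<psi>) = (if dB \<le> dA then p dB else 0)"
    by (simp add: CDP_B_eq_CDP_A[OF psd_ket_bra[OF assms(1)]] swap)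
  ultimately show ?thesis by auto
qed

end
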